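(* Let $H_1,H_2,H_3$ be hereditary and saturated point functors that are invariant under isomorphism. Then there is a natural isomorphism of functors $(H_1*H_2)*H_3\cong H_1*(H_2*H_3)$.
   Context: Graphs are directed graphs $E=(E^0,E^1,r,s)$, assumed row-finite ($s^{-1}(v)$ finite for all $v$). $K$ is a field. $L_K(E)$ is the Leavitt path algebra: the $K$-algebra generated by $E^0\cup E^1\cup\{e^*: e\in E^1\}$ with relations $vw=\delta_{v,w}v$, $s(e)e=e=e\,r(e)$, $r(e)e^*=e^*=e^*s(e)$, $e^*f=\delta_{e,f}r(e)$, and $v=\sum_{s(e)=v}ee^*$ for each regular vertex $v$ ($0<|s^{-1}(v)|<\infty$). $I(X)$ is the two-sided ideal generated by a set $X$ of vertices. A set $X\subseteq E^0$ is hereditary if whenever $v\in X$ and there is a path from $v$ to $w$, then $w\in X$; it is saturated if every regular vertex $v$ with $r(s^{-1}(v))\subseteq X$ lies in $X$. For $X$ hereditary and saturated, the quotient graph $E/X$ has vertex set $E^0\setminus X$ and edge set $\{e\in E^1: r(e)\notin X\}$; there is a canonical isomorphism $\theta\colon L_K(E)/I(X)\to L_K(E/X)$ sending the class of each vertex $v\notin X$, each edge $e$ with $r(e)\notin X$ and its ghost $e^*$ to the element of the same name. A point functor is a functor $H$ from the category of graphs (morphisms: graph isomorphisms) to sets such that $H(E)\subseteq E^0$ for every $E$ (a subfunctor of $E\mapsto E^0$); it is hereditary and saturated if each $H(E)$ is. $H$ is invariant under isomorphism if $f(I(H(E)))=I(H(F))$ for all graphs $E,F$ and every ring isomorphism $f\colon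 L_K(E)\to L_K(F)$. An isomorphism of functors is an invertible natural transformation. For hereditary and saturated point functors $H_1,H_2$, the point functor $H_2*H_1$ is defined as follows: for each graph $E$, $(H_2*H_1)(E)$ is the unique hereditary and saturated subset of $E^0$ containing $H_1(E)$ such that the canonical isomorphism $\theta\colon L_K(E)/I(H_1(E))\to L_K(E/H_1(E))$ maps $I[(H_2*H_1)(E)]/I(H_1(E))$ onto $I[H_2(E/H_1(E))]$. *)

theory Defs
  imports
    "Graph_Theory.Digraph_Isomorphism"
    "HOL-Library.Poly_Mapping"
    "HOL-Algebra.QuotRing"
    "HOL-Algebra.Module"
begin

section \<open>Row-finite graphs\<close>

text \<open>Here \<open>tail\<close> is the source map \<open>s\<close> and \<open>head\<close> is the range map \<open>r\<close>.\<close>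

definition row_finite :: "('v, 'e) pre_digraph \<Rightarrow> bool" where
  "row_finite E \<longleftrightarrow> wf_digraph E \<and> (\<forall>v\<in>verts E. finite (out_arcs E v))"

definition regular_vertex :: "('v, 'e) pre_digraph \<Rightarrow> 'v \<Rightarrow> bool" where
  "regular_vertex E v \<longleftrightarrow> v \<in> verts E \<and> out_arcs E v \<noteq> {} \<and> finite (out_arcs E v)"

definition hereditary :: "('v, 'e) pre_digraph \<Rightarrow> 'v set \<Rightarrow> bool" where
  "hereditary E X \<longleftrightarrow> X \<subseteq> verts E \<and> (\<forall>v\<in>X. \<forall>w. v \<rightarrow>\<^sup>*\<^bsub>E\<^esub> w \<longrightarrow> w \<in> X)"

definition saturated :: "('v, 'e) pre_digraph \<Rightarrow> 'v set \<Rightarrow> bool" where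
  "saturated E X \<longleftrightarrow> X \<subseteq> verts E \<and>
     (\<forall>v. regular_vertex E v \<and> head E ` out_arcs E v \<subseteq> X \<longrightarrow> v \<in> X)"

definition quotient_graph :: "('v, 'e) pre_digraph \<Rightarrow> 'v set \<Rightarrow> ('v, 'e) pre_digraph" where
  "quotient_graph E X =
     \<lparr>verts = verts E - X, arcs = {e \<in> arcs E. head E e \<notin> X}, tail = tail E, head = head E\<rparr>"

text \<open>
  A \<open>digraph_isomorphism\<close> record carries the source and range maps of its target, so
  requiring \<open>app_iso \<phi> E = F\<close> leaves exactly the vertex and edge bijections from \<open>E\<close>
  to \<open>F\<close> that commute with source and range.
\<close>

definition graph_iso ::
  "('v, 'e) pre_digraph \<Rightarrow> ('v, 'e) pre_digraph \<Rightarrow> ('v, 'e, 'v, 'e) digraph_isomorphism \<Rightarrow> bool"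
  where "graph_iso E F \<phi> \<longleftrightarrow> pre_digraph.digraph_isomorphism E \<phi> \<and> app_iso \<phi> E = F"


section \<open>Rings without unit and algebras\<close>

text \<open>
  Leavitt path algebras of graphs with infinitely many vertices have no unit, whereas
  \<open>ideal\<close>, \<open>genideal\<close> and \<open>ring_iso\<close> of HOL-Algebra presuppose one.  The records
  of HOL-Algebra are kept, but nothing below depends on the field \<open>one\<close>.
\<close>

definition two_sided_ideal :: "'a set \<Rightarrow> ('a, 'm) ring_scheme \<Rightarrow> bool" where
  "two_sided_ideal I R \<longleftrightarrow> additive_subgroup I R \<and>
     (\<forall>x\<in>carrier R. \<forall>a\<in>I. x \<otimes>\<^bsub>R\<^esub> a \<in> I \<and> a \<otimes>\<^bsub>R\<^esub> x \<in> I)"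

definition ideal_gen :: "('a, 'm) ring_scheme \<Rightarrow> 'a set \<Rightarrow> 'a set" where
  "ideal_gen R S = \<Inter>{I. two_sided_ideal I R \<and> S \<subseteq> I}"

definition algebra_ideal :: "'a set \<Rightarrow> ('k, 'a, 'm) module_scheme \<Rightarrow> bool" where
  "algebra_ideal I A \<longleftrightarrow> two_sided_ideal I A \<and> (\<forall>c. \<forall>a\<in>I. c \<odot>\<^bsub>A\<^esub> a \<in> I)"

definition algebra_ideal_gen :: "('k, 'a, 'm) module_scheme \<Rightarrow> 'a set \<Rightarrow> 'a set" where
  "algebra_ideal_gen A S = \<Inter>{I. algebra_ideal I A \<and> S \<subseteq> I}"

definition rng_iso :: "('a, 'm) ring_scheme \<Rightarrow> ('b, 'n) ring_scheme \<Rightarrow> ('a \<Rightarrow> 'b) set" where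
  "rng_iso R S = {f. bij_betw f (carrier R) (carrier S) \<and>
     (\<forall>x\<in>carrier R. \<forall>y\<in>carrier R.
        f (x \<oplus>\<^bsub>R\<^esub> y) = f x \<oplus>\<^bsub>S\<^esub> f y \<and> f (x \<otimes>\<^bsub>R\<^esub> y) = f x \<otimes>\<^bsub>S\<^esub> f y)}"

definition algebra_iso ::
  "('k, 'a, 'm) module_scheme \<Rightarrow> ('k, 'b, 'n) module_scheme \<Rightarrow> ('a \<Rightarrow> 'b) set" where
  "algebra_iso A B = {f \<in> rng_iso A B. \<forall>c. \<forall>x\<in>carrier A. f (c \<odot>\<^bsub>A\<^esub> x) = c \<odot>\<^bsub>B\<^esub> f x}"

text \<open>The ring \<open>A Quot I\<close> with the scalar action \<open>c (I + a) = I + c a\<close>.\<close>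

definition quot_algebra :: "('k, 'a, 'm) module_scheme \<Rightarrow> 'a set \<Rightarrow> ('k, 'a set) module" where
  "quot_algebra A I =
     ring.extend (A Quot I) (module.fields (\<lambda>c S. \<Union>a\<in>S. I +>\<^bsub>A\<^esub> (c \<odot>\<^bsub>A\<^esub> a)))"


section \<open>The free non-unital algebra on a set of generators\<close>

text \<open>
  The free monoid is wrapped in a type of its own in order to be an instance of
  \<open>monoid_add\<close>; finitely supported functions on it then multiply by convolution.
\<close>

datatype 'g free_word = FWord (letters: "'g list")

instantiation free_word :: (type) monoid_add
begin

definition zero_free_word :: "'a free_word" where
  "0 = FWord []"

definition plus_free_word :: "'a free_word \<Rightarrow> 'a free_word \<Rightarrow> 'a free_word" where
  "u + w = FWord (letters u @ letters w)"

instance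
  by standard (simp_all add: zero_free_word_def plus_free_word_def)

end

definition free_gen :: "'g \<Rightarrow> ('g free_word \<Rightarrow>\<^sub>0 'k::field)" where
  "free_gen g = Poly_Mapping.single (FWord [g]) 1"

text \<open>Only nonempty words occur, so the algebra has no unit; the field \<open>one\<close> is a dummy.\<close>

definition free_algebra :: "'g set \<Rightarrow> ('k::field, 'g free_word \<Rightarrow>\<^sub>0 'k) module" where
  "free_algebra G =
     \<lparr>carrier = {p. \<forall>w\<in>Poly_Mapping.keys p. letters w \<noteq> [] \<and> set (letters w) \<subseteq> G},
      mult = (*), one = 0, zero = 0, add = (+),
      smult = (\<lambda>c p. Poly_Mapping.map ((*) c) p)\<rparr>"


section \<open>Leavitt path algebras\<close>

datatype ('v, 'e) lpa_gen = Vert 'v | Edge 'e | Ghost 'e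

definition lpa_gens :: "('v, 'e) pre_digraph \<Rightarrow> ('v, 'e) lpa_gen set" where
  "lpa_gens E = Vert ` verts E \<union> Edge ` arcs E \<union> Ghost ` arcs E"

type_synonym ('v, 'e, 'k) free_elem = "('v, 'e) lpa_gen free_word \<Rightarrow>\<^sub>0 'k"

text \<open>An element \<open>a - b\<close> of this set stands for the defining relation \<open>a = b\<close>.\<close>

definition lpa_relators :: "('v, 'e) pre_digraph \<Rightarrow> ('v, 'e, 'k::field) free_elem set" where
  "lpa_relators E =
     {free_gen (Vert v) * free_gen (Vert w) - (if v = w then free_gen (Vert v) else 0) | v w.
        v \<in> verts E \<and> w \<in> verts E}
   \<union> {free_gen (Vert (tail E e)) * free_gen (Edge e) - free_gen (Edge e) | e. e \<in> arcs E}
   \<union> {free_gen (Edge e) * free_gen (Vert (head E e)) - free_gen (Edge e) | e. e \<in> arcs E}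
   \<union> {free_gen (Vert (head E e)) * free_gen (Ghost e) - free_gen (Ghost e) | e. e \<in> arcs E}
   \<union> {free_gen (Ghost e) * free_gen (Vert (tail E e)) - free_gen (Ghost e) | e. e \<in> arcs E}
   \<union> {free_gen (Ghost e) * free_gen (Edge f)
        - (if e = f then free_gen (Vert (head E e)) else 0) | e f. e \<in> arcs E \<and> f \<in> arcs E}
   \<union> {free_gen (Vert v) - (\<Sum>e\<in>out_arcs E v. free_gen (Edge e) * free_gen (Ghost e)) | v.
        regular_vertex E v}"

definition lpa_rel_ideal :: "('v, 'e) pre_digraph \<Rightarrow> ('v, 'e, 'k::field) free_elem set" where
  "lpa_rel_ideal E = algebra_ideal_gen (free_algebra (lpa_gens E)) (lpa_relators E)"

definition lpa :: "('v, 'e) pre_digraph \<Rightarrow> ('k::field, ('v, 'e, 'k) free_elem set) module" where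
  "lpa E = quot_algebra (free_algebra (lpa_gens E)) (lpa_rel_ideal E)"

definition lpa_elem ::
  "('v, 'e) pre_digraph \<Rightarrow> ('v, 'e) lpa_gen \<Rightarrow> ('v, 'e, 'k::field) free_elem set" where
  "lpa_elem E g = lpa_rel_ideal E +>\<^bsub>free_algebra (lpa_gens E)\<^esub> free_gen g"

definition vertex_ideal ::
  "('v, 'e) pre_digraph \<Rightarrow> 'v set \<Rightarrow> ('v, 'e, 'k::field) free_elem set set" where
  "vertex_ideal E X = ideal_gen (lpa E) ((\<lambda>v. lpa_elem E (Vert v)) ` X)"

definition lpa_mod ::
  "('v, 'e) pre_digraph \<Rightarrow> 'v set \<Rightarrow> ('k::field, ('v, 'e, 'k) free_elem set set) module" where
  "lpa_mod E X = quot_algebra (lpa E) (vertex_ideal E X)"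

definition lpa_class ::
  "('v, 'e) pre_digraph \<Rightarrow> 'v set \<Rightarrow> ('v, 'e, 'k::field) free_elem set \<Rightarrow>
     ('v, 'e, 'k) free_elem set set" where
  "lpa_class E X a = vertex_ideal E X +>\<^bsub>lpa E\<^esub> a"

text \<open>
  The canonical isomorphism \<open>\<theta>\<close> from \<open>L(E)/I(X)\<close> to \<open>L(E/X)\<close>, for \<open>X\<close> hereditary and
  saturated.  Linearity and the values on the given classes determine it on the carrier;
  extensionality fixes it outside the carrier.
\<close>

definition canonical_iso ::
  "('v, 'e) pre_digraph \<Rightarrow> 'v set \<Rightarrow>
     ('v, 'e, 'k::field) free_elem set set \<Rightarrow> ('v, 'e, 'k) free_elem set" where
  "canonical_iso E X = (THE \<theta>.
     \<theta> \<in> extensional (carrier (lpa_mod E X)) \<and>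
     \<theta> \<in> algebra_iso (lpa_mod E X) (lpa (quotient_graph E X)) \<and>
     (\<forall>v\<in>verts E - X.
        \<theta> (lpa_class E X (lpa_elem E (Vert v))) = lpa_elem (quotient_graph E X) (Vert v)) \<and>
     (\<forall>e\<in>arcs E. head E e \<notin> X \<longrightarrow>
        \<theta> (lpa_class E X (lpa_elem E (Edge e))) = lpa_elem (quotient_graph E X) (Edge e) \<and>
        \<theta> (lpa_class E X (lpa_elem E (Ghost e))) = lpa_elem (quotient_graph E X) (Ghost e)))"


section \<open>Point functors\<close>

text \<open>
  A point functor is given by its values on objects: being a subfunctor of \<open>E \<mapsto> E\<^sup>0\<close>,
  it sends a graph isomorphism to the restriction of the vertex map.  Values on graphs
  that are not row-finite are irrelevant.
\<close>

type_synonym ('v, 'e) point_map = "('v, 'e) pre_digraph \<Rightarrow> 'v set"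

definition point_functor :: "('v, 'e) point_map \<Rightarrow> bool" where
  "point_functor H \<longleftrightarrow>
     (\<forall>E. row_finite E \<longrightarrow> H E \<subseteq> verts E) \<and>
     (\<forall>E F \<phi>. row_finite E \<and> row_finite F \<and> graph_iso E F \<phi> \<longrightarrow> iso_verts \<phi> ` H E \<subseteq> H F)"

definition hereditary_saturated_functor :: "('v, 'e) point_map \<Rightarrow> bool" where
  "hereditary_saturated_functor H \<longleftrightarrow>
     (\<forall>E. row_finite E \<longrightarrow> hereditary E (H E) \<and> saturated E (H E))"

definition invariant_under_iso :: "'k::field itself \<Rightarrow> ('v, 'e) point_map \<Rightarrow> bool" where
  "invariant_under_iso K H \<longleftrightarrow>
     (\<forall>E F f. row_finite E \<and> row_finite F \<and>
        f \<in> rng_iso (lpa E :: ('k, ('v, 'e, 'k) free_elem set) module)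
                    (lpa F :: ('k, ('v, 'e, 'k) free_elem set) module) \<longrightarrow>
        f ` vertex_ideal E (H E) = vertex_ideal F (H F))"

definition point_star ::
  "'k::field itself \<Rightarrow> ('v, 'e) point_map \<Rightarrow> ('v, 'e) point_map \<Rightarrow> ('v, 'e) point_map" where
  "point_star K H2 H1 E = (THE Z.
     hereditary E Z \<and> saturated E Z \<and> H1 E \<subseteq> Z \<and>
     canonical_iso E (H1 E) `
         (lpa_class E (H1 E) ` (vertex_ideal E Z :: ('v, 'e, 'k) free_elem set set)) =
       vertex_ideal (quotient_graph E (H1 E)) (H2 (quotient_graph E (H1 E))))"

definition natural_transformation ::
  "('v, 'e) point_map \<Rightarrow> ('v, 'e) point_map \<Rightarrow> (('v, 'e) pre_digraph \<Rightarrow> 'v \<Rightarrow> 'v) \<Rightarrow> bool" where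
  "natural_transformation H H' \<eta> \<longleftrightarrow> point_functor H \<and> point_functor H' \<and>
     (\<forall>E. row_finite E \<longrightarrow> \<eta> E \<in> H E \<rightarrow> H' E) \<and>
     (\<forall>E F \<phi>. row_finite E \<and> row_finite F \<and> graph_iso E F \<phi> \<longrightarrow>
        (\<forall>x\<in>H E. \<eta> F (iso_verts \<phi> x) = iso_verts \<phi> (\<eta> E x)))"

definition natural_isomorphism ::
  "('v, 'e) point_map \<Rightarrow> ('v, 'e) point_map \<Rightarrow> (('v, 'e) pre_digraph \<Rightarrow> 'v \<Rightarrow> 'v) \<Rightarrow> bool" where
  "natural_isomorphism H H' \<eta> \<longleftrightarrow> natural_transformation H H' \<eta> \<and>
     (\<exists>\<zeta>. natural_transformation H' H \<zeta> \<and>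
        (\<forall>E. row_finite E \<longrightarrow>
           (\<forall>x\<in>H E. \<zeta> E (\<eta> E x) = x) \<and> (\<forall>y\<in>H' E. \<eta> E (\<zeta> E y) = y)))"

end

theory Submission
  imports Defs
begin

text \<open>
  On a row-finite graph \<open>(H\<^sub>2 * H\<^sub>1)(E) = H\<^sub>1(E) \<union> H\<^sub>2(E/H\<^sub>1(E))\<close>, and \<open>(E/X)/Y = E/(X \<union> Y)\<close>
  on the nose, so both bracketings have the same values and the identity is a natural isomorphism.

  The formula comes from a description of \<open>I(X)\<close> upstairs: all generators of \<open>E/X\<close> are
  generators of \<open>E\<close>, and deleting the words that contain a generator outside \<open>E/X\<close> is a
  homomorphism of free algebras; \<open>I(X)\<close> consists of the classes of those \<open>p\<close> that this
  deletion sends into the relation ideal of \<open>E/X\<close>.  The deletion thus induces \<open>\<theta>\<close>, and deleting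
  in two steps along \<open>X\<close> and \<open>Y\<close> shows that \<open>\<theta>\<close> carries \<open>I(X \<union> Y)\<close> onto \<open>I(Y)\<close>.  Uniqueness of
  the set defining \<open>H\<^sub>2 * H\<^sub>1\<close> amounts to the fact that vertices are nonzero in \<open>L(E/Z)\<close>, which
  is read off a representation.
\<close>


section \<open>Algebras without unit\<close>

text \<open>Two objects are definite descriptions, the map \<open>\<theta>\<close> and the value of
  a product, so each needs existence and uniqueness before it can be computed. Both are handled in
  the free algebra, because cosets of cosets are opaque whereas deleting words is an explicit map.
  Heredity and saturation are what makes deletion respect the relations: by heredity a surviving
  edge keeps its source, and by saturation a surviving vertex that emits edges keeps at least one of
  them. In the other direction every deleted generator lies in \<open>I(X)\<close>, so deletion
  changes nothing modulo \<open>I(X)\<close>. Nontriviality enters at one point only, the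
  nonvanishing of vertices; a module with a nonzero block at each vertex takes the place of a normal
  form, and the blocks are infinite so that one of them can be split into several.\<close>

locale rng_algebra = abelian_group A
  for A :: "('k, 'a, 'm) module_scheme" (structure) +
  assumes m_closed [simp, intro]: "x \<in> carrier A \<Longrightarrow> y \<in> carrier A \<Longrightarrow> x \<otimes> y \<in> carrier A"
    and m_assoc: "x \<in> carrier A \<Longrightarrow> y \<in> carrier A \<Longrightarrow> z \<in> carrier A \<Longrightarrow>
      (x \<otimes> y) \<otimes> z = x \<otimes> (y \<otimes> z)"
    and l_distr: "x \<in> carrier A \<Longrightarrow> y \<in> carrier A \<Longrightarrow> z \<in> carrier A \<Longrightarrow>
      (x \<oplus> y) \<otimes> z = x \<otimes> z \<oplus> y \<otimes> z"
    and r_distr: "x \<in> carrier A \<Longrightarrow> y \<in> carrier A \<Longrightarrow> z \<in> carrier A \<Longrightarrow>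
      z \<otimes> (x \<oplus> y) = z \<otimes> x \<oplus> z \<otimes> y"
    and smult_closed [simp, intro]: "x \<in> carrier A \<Longrightarrow> c \<odot> x \<in> carrier A"
    and smult_r_distr: "x \<in> carrier A \<Longrightarrow> y \<in> carrier A \<Longrightarrow> c \<odot> (x \<oplus> y) = c \<odot> x \<oplus> c \<odot> y"
    and smult_assoc2: "x \<in> carrier A \<Longrightarrow> y \<in> carrier A \<Longrightarrow> (c \<odot> x) \<otimes> y = c \<odot> (x \<otimes> y)"
    and smult_assoc3: "x \<in> carrier A \<Longrightarrow> y \<in> carrier A \<Longrightarrow> x \<otimes> (c \<odot> y) = c \<odot> (x \<otimes> y)"

definition algebra_hom ::
  "('k, 'a, 'm) module_scheme \<Rightarrow> ('k, 'b, 'n) module_scheme \<Rightarrow> ('a \<Rightarrow> 'b) set" where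
  "algebra_hom A B = {f. f \<in> carrier A \<rightarrow> carrier B \<and>
     (\<forall>x\<in>carrier A. \<forall>y\<in>carrier A.
        f (x \<oplus>\<^bsub>A\<^esub> y) = f x \<oplus>\<^bsub>B\<^esub> f y \<and> f (x \<otimes>\<^bsub>A\<^esub> y) = f x \<otimes>\<^bsub>B\<^esub> f y) \<and>
     (\<forall>c. \<forall>x\<in>carrier A. f (c \<odot>\<^bsub>A\<^esub> x) = c \<odot>\<^bsub>B\<^esub> f x)}"

lemma algebra_homD:
  assumes "f \<in> algebra_hom A B" "x \<in> carrier A"
  shows "f x \<in> carrier B"
    and "y \<in> carrier A \<Longrightarrow> f (x \<oplus>\<^bsub>A\<^esub> y) = f x \<oplus>\<^bsub>B\<^esub> f y"
    and "y \<in> carrier A \<Longrightarrow> f (x \<otimes>\<^bsub>A\<^esub> y) = f x \<otimes>\<^bsub>B\<^esub> f y"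
    and "f (c \<odot>\<^bsub>A\<^esub> x) = c \<odot>\<^bsub>B\<^esub> f x"
  using assms by (auto simp: algebra_hom_def)

lemma algebra_hom_comp:
  assumes "f \<in> algebra_hom A B" "g \<in> algebra_hom B C"
  shows "(\<lambda>x. g (f x)) \<in> algebra_hom A C"
  using assms unfolding algebra_hom_def by (simp add: Pi_iff)

lemma rng_algebra_surj:
  assumes "rng_algebra A" and f: "f \<in> algebra_hom A B" and surj: "f ` carrier A = carrier B"
    and zero: "f \<zero>\<^bsub>A\<^esub> = \<zero>\<^bsub>B\<^esub>"
  shows "rng_algebra B"
proof -
  interpret A: rng_algebra A by fact
  note hom [simp] = algebra_homD(2-4)[OF f, symmetric]
  have lift: "P" if "y \<in> carrier B" "\<And>x. x \<in> carrier A \<Longrightarrow> y = f x \<Longrightarrow> P" for y P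
    using that surj by auto
  have closed [simp]: "f x \<in> carrier B" if "x \<in> carrier A" for x
    using that by (rule algebra_homD(1)[OF f])
  have "abelian_group B"
  proof (rule abelian_groupI)
    show "\<zero>\<^bsub>B\<^esub> \<in> carrier B"
      using closed[OF A.zero_closed] zero by simp
  next
    fix x assume "x \<in> carrier B"
    then obtain a where a: "a \<in> carrier A" "x = f a"
      by (rule lift)
    then show "\<zero>\<^bsub>B\<^esub> \<oplus>\<^bsub>B\<^esub> x = x"
      by (simp add: zero[symmetric])
    show "\<exists>y\<in>carrier B. y \<oplus>\<^bsub>B\<^esub> x = \<zero>\<^bsub>B\<^esub>"
      using a by (intro bexI[of _ "f (\<ominus>\<^bsub>A\<^esub> a)"]) (simp_all add: zero[symmetric] A.l_neg)
  qed (auto elim!: lift simp: A.a_assoc, auto elim!: lift simp: A.a_comm)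
  moreover have "rng_algebra_axioms B"
    by standard (auto elim!: lift simp: A.m_assoc A.l_distr A.r_distr A.smult_r_distr
          A.smult_assoc2 A.smult_assoc3)
  ultimately show ?thesis
    by (rule rng_algebra.intro)
qed

section \<open>Zero and signs\<close>

context rng_algebra
begin

text \<open>Additive cancellation. It stands behind every statement that an additive map sends zero
  to zero: scalar multiplication, multiplication from either side, homomorphisms.\<close>

lemma idem_eq_zero:
  assumes "x \<in> carrier A" "x \<oplus> x = x"
  shows "x = \<zero>"
  using assms by (metis add.l_cancel_one')

lemma smult_minus:
  assumes "x \<in> carrier A"
  shows "c \<odot> (\<ominus> x) = \<ominus> (c \<odot> x)"
proof -
  have 0: "c \<odot> \<zero> = \<zero>"
    using smult_r_distr[of \<zero> \<zero> c] by (intro idem_eq_zero) simp_all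
  have "c \<odot> (\<ominus> x) \<oplus> c \<odot> x = \<zero>"
    using smult_r_distr[of "\<ominus> x" x c] assms by (simp add: 0 l_neg)
  then show ?thesis
    using assms by (intro minus_equality[symmetric]) simp_all
qed

lemma m_minus_left:
  assumes "x \<in> carrier A" "y \<in> carrier A"
  shows "(\<ominus> x) \<otimes> y = \<ominus> (x \<otimes> y)"
proof -
  have 0: "\<zero> \<otimes> y = \<zero>"
    using l_distr[of \<zero> \<zero> y] assms by (intro idem_eq_zero) simp_all
  have "(\<ominus> x) \<otimes> y \<oplus> x \<otimes> y = \<zero>"
    using l_distr[of "\<ominus> x" x y] assms by (simp add: 0 l_neg)
  then show ?thesis
    using assms by (intro minus_equality[symmetric]) simp_all
qed

lemma m_minus_right:
  assumes "x \<in> carrier A" "y \<in> carrier A"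
  shows "y \<otimes> (\<ominus> x) = \<ominus> (y \<otimes> x)"
proof -
  have 0: "y \<otimes> \<zero> = \<zero>"
    using r_distr[of \<zero> \<zero> y] assms by (intro idem_eq_zero) simp_all
  have "y \<otimes> (\<ominus> x) \<oplus> y \<otimes> x = \<zero>"
    using r_distr[of "\<ominus> x" x y] assms by (simp add: 0 l_neg)
  then show ?thesis
    using assms by (intro minus_equality[symmetric]) simp_all
qed

end

section \<open>The quotient by an algebra ideal\<close>

context
  fixes A :: "('k, 'a, 'm) module_scheme" (structure) and I :: "'a set"
  assumes A: "rng_algebra A" and I: "algebra_ideal I A"
begin

interpretation rng_algebra A by (rule A)

interpretation abelian_subgroup I A
  using I by (intro abelian_subgroupI3)
    (simp_all add: algebra_ideal_def two_sided_ideal_def abelian_group_axioms)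

lemma coset_eq_iff:
  assumes "x \<in> carrier A" "y \<in> carrier A"
  shows "I +> x = I +> y \<longleftrightarrow> x \<ominus> y \<in> I"
  using assms a_rcos_module[of y x] a_repr_independence'[of x y] a_rcos_self[of x]
  unfolding minus_eq by (metis abelian_group_axioms)

lemma ideal_closed:
  assumes "x \<in> carrier A" "a \<in> I"
  shows "x \<otimes> a \<in> I" "a \<otimes> x \<in> I"
  using I assms by (auto simp: algebra_ideal_def two_sided_ideal_def)

lemma ideal_smult_closed: "a \<in> I \<Longrightarrow> c \<odot> a \<in> I"
  using I by (auto simp: algebra_ideal_def)

text \<open>Product and scalar action of the quotient are unions over all representatives. A
  function that is constant on a congruence class has a one-element family of values there, so the
  union collapses to any one of them.\<close>

lemma coset_Union:
  assumes "x \<in> carrier A"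
    and g: "\<And>y. y \<in> carrier A \<Longrightarrow> x \<ominus> y \<in> I \<Longrightarrow> g x = g y"
  shows "(\<Union>y\<in>I +> x. g y) = g x"
proof -
  have "g y = g x" if "y \<in> I +> x" for y
    using that assms coset_eq_iff[of x y] a_repr_independence'[of y x] a_elemrcos_carrier[of x y]
    by (metis abelian_group_axioms)
  moreover have "x \<in> I +> x"
    using assms by (simp add: a_rcos_self)
  ultimately show ?thesis
    by blast
qed

lemma carrier_quot_algebra: "carrier (quot_algebra A I) = (+>) I ` carrier A"
  by (auto simp: quot_algebra_def FactRing_def A_RCOSETS_def' a_r_coset_def' ring.defs module.defs)

lemma coset_smult:
  assumes "x \<in> carrier A"
  shows "c \<odot>\<^bsub>quot_algebra A I\<^esub> (I +> x) = I +> (c \<odot> x)"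
proof -
  have "(\<Union>y\<in>I +> x. I +> (c \<odot> y)) = I +> (c \<odot> x)"
  proof (rule coset_Union[OF assms])
    fix y assume y: "y \<in> carrier A" "x \<ominus> y \<in> I"
    have "c \<odot> x \<ominus> c \<odot> y = c \<odot> (x \<ominus> y)"
      using y assms by (simp add: minus_eq smult_r_distr smult_minus)
    then show "I +> (c \<odot> x) = I +> (c \<odot> y)"
      using y assms ideal_smult_closed[of "x \<ominus> y" c] by (simp add: coset_eq_iff)
  qed
  then show ?thesis
    by (simp add: quot_algebra_def ring.defs module.defs)
qed

lemma coset_mult:
  assumes "x \<in> carrier A" "y \<in> carrier A"
  shows "(I +> x) \<otimes>\<^bsub>quot_algebra A I\<^esub> (I +> y) = I +> (x \<otimes> y)"
proof -
  \<comment> \<open>The product of cosets is a double union; the inner one is collapsed for each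
    fixed left factor, the outer one afterwards.\<close>
  have "(\<Union>b\<in>I +> y. I +> (a \<otimes> b)) = I +> (a \<otimes> y)" if a: "a \<in> carrier A" for a
  proof (rule coset_Union[OF assms(2)])
    fix b assume b: "b \<in> carrier A" "y \<ominus> b \<in> I"
    have "a \<otimes> y \<ominus> a \<otimes> b = a \<otimes> (y \<ominus> b)"
      using a b assms by (simp add: minus_eq r_distr m_minus_right)
    then show "I +> (a \<otimes> y) = I +> (a \<otimes> b)"
      using a b assms ideal_closed[of a "y \<ominus> b"] by (simp add: coset_eq_iff)
  qed
  then have "(\<Union>a\<in>I +> x. \<Union>b\<in>I +> y. I +> (a \<otimes> b)) = (\<Union>a\<in>I +> x. I +> (a \<otimes> y))"
    using assms by (intro SUP_cong) (auto dest: a_elemrcos_carrier)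
  also have "\<dots> = I +> (x \<otimes> y)"
  proof (rule coset_Union[OF assms(1)])
    fix a assume a: "a \<in> carrier A" "x \<ominus> a \<in> I"
    have "x \<otimes> y \<ominus> a \<otimes> y = (x \<ominus> a) \<otimes> y"
      using a assms by (simp add: minus_eq l_distr m_minus_left)
    then show "I +> (x \<otimes> y) = I +> (a \<otimes> y)"
      using a assms ideal_closed[of y "x \<ominus> a"] by (simp add: coset_eq_iff)
  qed
  finally show ?thesis
    by (simp add: quot_algebra_def FactRing_def rcoset_mult_def ring.defs module.defs)
qed

lemma quot_algebra_hom: "(+>) I \<in> algebra_hom A (quot_algebra A I)"
proof -
  have "(I +> x) \<oplus>\<^bsub>quot_algebra A I\<^esub> (I +> y) = I +> (x \<oplus> y)"
    if "x \<in> carrier A" "y \<in> carrier A" for x y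
    using that a_rcos_sum[of x y]
    by (simp add: quot_algebra_def FactRing_def ring.defs module.defs)
  then show ?thesis
    by (auto simp: algebra_hom_def carrier_quot_algebra coset_mult coset_smult)
qed

lemma zero_quot_algebra: "\<zero>\<^bsub>quot_algebra A I\<^esub> = I +> \<zero>"
  using a_coset_add_zero[OF a_subset]
  by (simp add: quot_algebra_def FactRing_def ring.defs module.defs)

lemma rng_algebra_quot_algebra: "rng_algebra (quot_algebra A I)"
  using A quot_algebra_hom carrier_quot_algebra[symmetric] zero_quot_algebra[symmetric]
  by (rule rng_algebra_surj)

end

section \<open>Two-sided ideals and generation\<close>

context rng_algebra
begin

lemma two_sided_idealI:
  assumes "I \<subseteq> carrier A" "\<zero> \<in> I"
    and "\<And>x y. x \<in> I \<Longrightarrow> y \<in> I \<Longrightarrow> x \<oplus> y \<in> I"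
    and "\<And>x. x \<in> I \<Longrightarrow> \<ominus> x \<in> I"
    and "\<And>x a. x \<in> carrier A \<Longrightarrow> a \<in> I \<Longrightarrow> x \<otimes> a \<in> I"
    and "\<And>x a. x \<in> carrier A \<Longrightarrow> a \<in> I \<Longrightarrow> a \<otimes> x \<in> I"
  shows "two_sided_ideal I A"
proof -
  have "subgroup I (add_monoid A)"
    using assms by (intro group.subgroupI a_group) (auto simp: a_inv_def)
  then show ?thesis
    using assms by (simp add: two_sided_ideal_def additive_subgroup_def)
qed

lemma two_sided_idealD:
  assumes "two_sided_ideal I A"
  shows "I \<subseteq> carrier A" "\<zero> \<in> I"
    and "x \<in> I \<Longrightarrow> y \<in> I \<Longrightarrow> x \<oplus> y \<in> I"
    and "x \<in> I \<Longrightarrow> \<ominus> x \<in> I"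
    and "x \<in> carrier A \<Longrightarrow> a \<in> I \<Longrightarrow> x \<otimes> a \<in> I"
    and "x \<in> carrier A \<Longrightarrow> a \<in> I \<Longrightarrow> a \<otimes> x \<in> I"
proof -
  interpret additive_subgroup I A
    using assms by (simp add: two_sided_ideal_def)
  show "I \<subseteq> carrier A" "\<zero> \<in> I" "x \<in> I \<Longrightarrow> y \<in> I \<Longrightarrow> x \<oplus> y \<in> I"
    by (auto simp: a_subset a_closed)
  show "x \<in> I \<Longrightarrow> \<ominus> x \<in> I"
    by (rule a_inv_closed)
  show "x \<in> carrier A \<Longrightarrow> a \<in> I \<Longrightarrow> x \<otimes> a \<in> I" "x \<in> carrier A \<Longrightarrow> a \<in> I \<Longrightarrow> a \<otimes> x \<in> I"
    using assms unfolding two_sided_ideal_def by blast+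
qed

lemma two_sided_ideal_carrier: "two_sided_ideal (carrier A) A"
  by (rule two_sided_idealI) auto

lemma two_sided_ideal_Inter:
  assumes "F \<noteq> {}" "\<And>I. I \<in> F \<Longrightarrow> two_sided_ideal I A"
  shows "two_sided_ideal (\<Inter>F) A"
proof (rule two_sided_idealI)
  show "\<Inter>F \<subseteq> carrier A"
    using assms two_sided_idealD(1) by blast
  show "\<zero> \<in> \<Inter>F"
    using assms(2) two_sided_idealD(2) by blast
  show "x \<oplus> y \<in> \<Inter>F" if "x \<in> \<Inter>F" "y \<in> \<Inter>F" for x y
    using that by (intro InterI two_sided_idealD(3)[OF assms(2)]) (auto dest: InterD)
  show "\<ominus> x \<in> \<Inter>F" if "x \<in> \<Inter>F" for x
    using that by (intro InterI two_sided_idealD(4)[OF assms(2)]) (auto dest: InterD)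
  show "x \<otimes> a \<in> \<Inter>F" "a \<otimes> x \<in> \<Inter>F" if "x \<in> carrier A" "a \<in> \<Inter>F" for x a
    using that by (intro InterI two_sided_idealD(5,6)[OF assms(2)]; auto dest: InterD)+
qed

lemma ideal_gen:
  assumes "S \<subseteq> carrier A"
  shows "two_sided_ideal (ideal_gen A S) A"
  unfolding ideal_gen_def
proof (rule two_sided_ideal_Inter)
  show "{I. two_sided_ideal I A \<and> S \<subseteq> I} \<noteq> {}"
    using assms two_sided_ideal_carrier by blast
qed simp

lemma algebra_ideal_gen:
  assumes "S \<subseteq> carrier A"
  shows "algebra_ideal (algebra_ideal_gen A S) A"
proof -
  let ?F = "{I. algebra_ideal I A \<and> S \<subseteq> I}"
  have ts: "two_sided_ideal I A" and sm: "a \<in> I \<Longrightarrow> c \<odot> a \<in> I" if "I \<in> ?F" for I a c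
    using that by (simp_all add: algebra_ideal_def)
  have "carrier A \<in> ?F"
    using assms two_sided_ideal_carrier by (simp add: algebra_ideal_def)
  then have "two_sided_ideal (\<Inter>?F) A"
    using ts by (intro two_sided_ideal_Inter) blast+
  moreover have "c \<odot> a \<in> \<Inter>?F" if "a \<in> \<Inter>?F" for a c
    using that sm by (intro InterI) (blast dest: InterD)
  ultimately show ?thesis
    unfolding algebra_ideal_def[of "algebra_ideal_gen A S"]
    unfolding algebra_ideal_gen_def by blast
qed

text \<open>\<open>c s = (c s) s\<close> for idempotent \<open>s\<close>, so scalars come for free.\<close>

lemma algebra_ideal_ideal_gen_idem:
  assumes S: "S \<subseteq> carrier A" and idem: "\<And>s. s \<in> S \<Longrightarrow> s \<otimes> s = s"
  shows "algebra_ideal (ideal_gen A S) A"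
proof -
  let ?I = "ideal_gen A S"
  \<comment> \<open>\<open>?T\<close> is the part of the ring ideal that all scalars keep inside. It
    is itself a ring ideal and contains \<open>S\<close>, so minimality makes it everything.\<close>
  let ?T = "{a \<in> ?I. \<forall>c. c \<odot> a \<in> ?I}"
  note I = two_sided_idealD[OF ideal_gen[OF S]]
  have carr: "a \<in> carrier A" if "a \<in> ?I" for a
    using that I(1) by blast
  have 0: "c \<odot> \<zero> = \<zero>" for c
    using smult_r_distr[of \<zero> \<zero> c] by (intro idem_eq_zero) simp_all
  have "two_sided_ideal ?T A"
  proof (rule two_sided_idealI)
    show "?T \<subseteq> carrier A" "\<zero> \<in> ?T"
      using I(1,2) by (auto simp: 0)
    show "x \<oplus> y \<in> ?T" if "x \<in> ?T" "y \<in> ?T" for x y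
      using that I(3) carr smult_r_distr by simp
    show "\<ominus> x \<in> ?T" if "x \<in> ?T" for x
      using that I(4) carr smult_minus by simp
    show "x \<otimes> a \<in> ?T" "a \<otimes> x \<in> ?T" if "x \<in> carrier A" "a \<in> ?T" for x a
      using that I(5,6) carr by (simp_all add: smult_assoc2[symmetric])
  qed
  moreover have "S \<subseteq> ?T"
  proof
    fix s assume s: "s \<in> S"
    then have "s \<in> ?I"
      by (auto simp: ideal_gen_def)
    moreover have "c \<odot> s \<in> ?I" for c
    proof -
      have "(c \<odot> s) \<otimes> s \<in> ?I"
        using I(5) \<open>s \<in> ?I\<close> carr by simp
      then show ?thesis
        using s S idem[OF s] by (simp add: smult_assoc2 subset_iff)
    qed
    ultimately show "s \<in> ?T"
      by simp
  qed
  ultimately have "?I \<subseteq> ?T"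
    unfolding ideal_gen_def[of A S] by (intro Inter_lower) (simp add: ideal_gen_def)
  then show ?thesis
    using ideal_gen[OF S] by (auto simp: algebra_ideal_def)
qed

end

lemma subset_algebra_ideal_gen: "S \<subseteq> algebra_ideal_gen A S"
  and algebra_ideal_gen_least: "algebra_ideal I A \<Longrightarrow> S \<subseteq> I \<Longrightarrow> algebra_ideal_gen A S \<subseteq> I"
  and subset_ideal_gen: "S \<subseteq> ideal_gen A S"
  and ideal_gen_least: "two_sided_ideal I A \<Longrightarrow> S \<subseteq> I \<Longrightarrow> ideal_gen A S \<subseteq> I"
  by (auto simp: algebra_ideal_gen_def ideal_gen_def)

section \<open>Homomorphisms and ideals\<close>

context
  fixes A :: "('k, 'a, 'm) module_scheme" and B :: "('k, 'b, 'n) module_scheme" and f :: "'a \<Rightarrow> 'b"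
  assumes A: "rng_algebra A" and B: "rng_algebra B" and f: "f \<in> algebra_hom A B"
begin

interpretation A: rng_algebra A by (rule A)
interpretation B: rng_algebra B by (rule B)

lemma algebra_hom_zero: "f \<zero>\<^bsub>A\<^esub> = \<zero>\<^bsub>B\<^esub>"
  using algebra_homD(1)[OF f A.zero_closed] algebra_homD(2)[OF f A.zero_closed, of "\<zero>\<^bsub>A\<^esub>"] by (intro B.idem_eq_zero) simp_all

lemma algebra_hom_minus:
  assumes "x \<in> carrier A"
  shows "f (\<ominus>\<^bsub>A\<^esub> x) = \<ominus>\<^bsub>B\<^esub> f x"
  using algebra_homD(2)[OF f, of "\<ominus>\<^bsub>A\<^esub> x" x] assms
  by (intro B.minus_equality[symmetric]) (simp_all add: A.l_neg algebra_hom_zero algebra_homD(1)[OF f])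

lemma algebra_ideal_vimage:
  assumes "algebra_ideal I B"
  shows "algebra_ideal {x \<in> carrier A. f x \<in> I} A"
proof -
  have "two_sided_ideal I B"
    using assms by (simp add: algebra_ideal_def)
  note I = B.two_sided_idealD[OF this]
  have "two_sided_ideal {x \<in> carrier A. f x \<in> I} A"
    using assms by (intro A.two_sided_idealI)
      (auto simp: algebra_ideal_def algebra_homD[OF f] algebra_hom_zero algebra_hom_minus I)
  then show ?thesis
    using assms by (auto simp: algebra_ideal_def algebra_homD[OF f])
qed

lemma algebra_ideal_image:
  assumes "algebra_ideal I A" and surj: "f ` carrier A = carrier B"
  shows "algebra_ideal (f ` I) B"
proof -
  have tsI: "two_sided_ideal I A"
    using assms by (simp add: algebra_ideal_def)
  note I = A.two_sided_idealD[OF tsI]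
  have carr: "x \<in> carrier A" if "x \<in> I" for x
    using that I(1) by blast
  have "two_sided_ideal (f ` I) B"
  proof (rule B.two_sided_idealI)
    show "f ` I \<subseteq> carrier B"
      using surj I(1) by auto
    show "\<zero>\<^bsub>B\<^esub> \<in> f ` I"
      using I(2) algebra_hom_zero by force
    show "x \<oplus>\<^bsub>B\<^esub> y \<in> f ` I" if "x \<in> f ` I" "y \<in> f ` I" for x y
      using that by (auto simp: algebra_homD(2)[OF f, symmetric] carr I)
    show "\<ominus>\<^bsub>B\<^esub> x \<in> f ` I" if "x \<in> f ` I" for x
      using that by (auto simp: algebra_hom_minus[symmetric] carr I)
    show "x \<otimes>\<^bsub>B\<^esub> y \<in> f ` I" "y \<otimes>\<^bsub>B\<^esub> x \<in> f ` I" if "x \<in> carrier B" "y \<in> f ` I" for x y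
      using that unfolding surj[symmetric]
      by (auto simp: algebra_homD(3)[OF f, symmetric] carr I)
  qed
  moreover have "c \<odot>\<^bsub>B\<^esub> x \<in> f ` I" if "x \<in> f ` I" for c x
    using that assms(1) carr by (auto simp: algebra_homD(4)[OF f, symmetric] algebra_ideal_def)
  ultimately show ?thesis
    by (simp add: algebra_ideal_def)
qed

end

text \<open>The first isomorphism theorem in symmetric form: two surjections with the same fibres
  have isomorphic targets. The value at \<open>b\<close> is \<open>g\<close> of some preimage of
  \<open>b\<close>, and \<open>ker\<close> makes the choice immaterial. The restriction to the
  carrier provides the extensionality that \<open>canonical_iso\<close> demands.\<close>

lemma algebra_iso_of_surj:
  assumes f: "f \<in> algebra_hom A B" "f ` carrier A = carrier B"
    and g: "g \<in> algebra_hom A C" "g ` carrier A = carrier C"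
    and ker: "\<And>x y. x \<in> carrier A \<Longrightarrow> y \<in> carrier A \<Longrightarrow> f x = f y \<longleftrightarrow> g x = g y"
    and A: "\<And>x y c. x \<in> carrier A \<Longrightarrow> y \<in> carrier A \<Longrightarrow>
      x \<oplus>\<^bsub>A\<^esub> y \<in> carrier A \<and> x \<otimes>\<^bsub>A\<^esub> y \<in> carrier A \<and> c \<odot>\<^bsub>A\<^esub> x \<in> carrier A"
  obtains \<theta> where "\<theta> \<in> algebra_iso B C" "\<And>x. x \<in> carrier A \<Longrightarrow> \<theta> (f x) = g x"
    "\<theta> \<in> extensional (carrier B)"
proof
  define \<theta> where "\<theta> = restrict (\<lambda>b. g (inv_into (carrier A) f b)) (carrier B)"
  show ext: "\<theta> \<in> extensional (carrier B)"
    by (simp add: \<theta>_def)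
  show eq: "\<theta> (f x) = g x" if "x \<in> carrier A" for x
  proof -
    have "f (inv_into (carrier A) f (f x)) = f x" "inv_into (carrier A) f (f x) \<in> carrier A"
      using that by (auto intro: f_inv_into_f inv_into_into)
    then have "g (inv_into (carrier A) f (f x)) = g x"
      using ker that by blast
    then show ?thesis
      using that f by (auto simp: \<theta>_def)
  qed
  have "bij_betw \<theta> (carrier B) (carrier C)"
  proof (rule bij_betw_imageI)
    show "inj_on \<theta> (carrier B)"
      unfolding f(2)[symmetric] by (rule inj_onI) (auto simp: eq ker)
    show "\<theta> ` carrier B = carrier C"
      unfolding f(2)[symmetric] g(2)[symmetric] by (force simp: eq)
  qed
  moreover have "\<theta> (x \<oplus>\<^bsub>B\<^esub> y) = \<theta> x \<oplus>\<^bsub>C\<^esub> \<theta> y \<and> \<theta> (x \<otimes>\<^bsub>B\<^esub> y) = \<theta> x \<otimes>\<^bsub>C\<^esub> \<theta> y"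
    if "x \<in> carrier B" "y \<in> carrier B" for x y
    using that unfolding f(2)[symmetric]
    by (auto simp: algebra_homD(2,3)[OF f(1), symmetric] eq A algebra_homD(2,3)[OF g(1)])
  moreover have "\<theta> (c \<odot>\<^bsub>B\<^esub> x) = c \<odot>\<^bsub>C\<^esub> \<theta> x" if "x \<in> carrier B" for x c
    using that unfolding f(2)[symmetric]
    by (auto simp: algebra_homD(4)[OF f(1), symmetric] eq A algebra_homD(4)[OF g(1)])
  ultimately show "\<theta> \<in> algebra_iso B C"
    by (simp add: algebra_iso_def rng_iso_def)
qed

section \<open>The free algebra\<close>

text \<open>Monomials are only met at words in the support of the given \<open>p\<close>. This is
  how \<open>free_algebra_induct\<close> knows that its words are nonempty and use letters of
  \<open>G\<close>.\<close>

lemma poly_mapping_single_induct [case_names zero single add]: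
  fixes p :: "'a \<Rightarrow>\<^sub>0 'b::comm_monoid_add"
  assumes "P 0" and single: "\<And>w c. w \<in> Poly_Mapping.keys p \<Longrightarrow> P (Poly_Mapping.single w c)"
    and add: "\<And>p q. P p \<Longrightarrow> P q \<Longrightarrow> P (p + q)"
  shows "P p"
proof -
  let ?s = "\<lambda>S. \<Sum>w\<in>S. Poly_Mapping.single w (Poly_Mapping.lookup p w)"
  have "P (?s S)" if "finite S" "S \<subseteq> Poly_Mapping.keys p" for S
    using that by (induction S) (auto intro: assms)
  moreover have "?s (Poly_Mapping.keys p) = p"
    by (rule poly_mapping_eqI)
      (simp add: lookup_sum lookup_single when_def in_keys_iff)
  ultimately show ?thesis
    using finite_keys by (metis order_refl)
qed

text \<open>A scalar is a multiple of the empty word: outside the carrier of the non-unital algebra,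
  yet central in the ambient unital ring. Scalar action thereby becomes multiplication, and the ring
  laws cover it.\<close>

lemma single_zero_commute:
  fixes p :: "'a::monoid_add \<Rightarrow>\<^sub>0 'k::field"
  shows "p * Poly_Mapping.single 0 c = Poly_Mapping.single 0 c * p"
  by (induction p rule: poly_mapping_single_induct)
    (simp_all add: mult_single distrib_left distrib_right mult.commute)

lemma mult_free_algebra [simp]: "x \<otimes>\<^bsub>free_algebra G\<^esub> y = x * y"
  and zero_free_algebra [simp]: "\<zero>\<^bsub>free_algebra G\<^esub> = 0"
  and add_free_algebra [simp]: "x \<oplus>\<^bsub>free_algebra G\<^esub> y = x + y"
  and smult_free_algebra [simp]: "c \<odot>\<^bsub>free_algebra G\<^esub> x = Poly_Mapping.single 0 c * x"
  by (simp_all add: free_algebra_def mult_map_scale_conv_mult)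

lemma mem_free_algebra: "p \<in> carrier (free_algebra G) \<longleftrightarrow>
    (\<forall>w\<in>Poly_Mapping.keys p. letters w \<noteq> [] \<and> set (letters w) \<subseteq> G)"
  by (simp add: free_algebra_def)

lemma mem_free_algebra_mono:
  "p \<in> carrier (free_algebra G) \<Longrightarrow> G \<subseteq> G' \<Longrightarrow> p \<in> carrier (free_algebra G')"
  unfolding mem_free_algebra by blast

lemma free_algebra_closed:
  assumes "p \<in> carrier (free_algebra G)"
  shows "q \<in> carrier (free_algebra G) \<Longrightarrow> p + q \<in> carrier (free_algebra G)"
    and "q \<in> carrier (free_algebra G) \<Longrightarrow> p - q \<in> carrier (free_algebra G)"
    and "- p \<in> carrier (free_algebra G)"
    and "q \<in> carrier (free_algebra G) \<Longrightarrow> p * q \<in> carrier (free_algebra G)"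
    and "Poly_Mapping.single 0 c * p \<in> carrier (free_algebra G)"
proof -
  show "p + q \<in> carrier (free_algebra G)" if "q \<in> carrier (free_algebra G)"
    using that assms Poly_Mapping.keys_add[of p q] unfolding mem_free_algebra by blast
  show "p - q \<in> carrier (free_algebra G)" if "q \<in> carrier (free_algebra G)"
    using that assms keys_diff[of p q] unfolding mem_free_algebra by blast
  show "- p \<in> carrier (free_algebra G)"
    using assms unfolding mem_free_algebra by simp
  show "p * q \<in> carrier (free_algebra G)" if "q \<in> carrier (free_algebra G)"
    using that assms keys_mult[of p q] unfolding mem_free_algebra
    by (fastforce simp: plus_free_word_def)
  show "Poly_Mapping.single 0 c * p \<in> carrier (free_algebra G)"
    using assms keys_mult[of "Poly_Mapping.single 0 c" p] unfolding mem_free_algebra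
    by (fastforce simp: plus_free_word_def zero_free_word_def split: if_splits)
qed

lemma zero_mem_free_algebra [simp]: "0 \<in> carrier (free_algebra G)"
  by (simp add: mem_free_algebra)

lemma sum_mem_free_algebra:
  "(\<And>i. i \<in> S \<Longrightarrow> f i \<in> carrier (free_algebra G)) \<Longrightarrow> sum f S \<in> carrier (free_algebra G)"
  by (induction S rule: infinite_finite_induct) (auto intro: free_algebra_closed)

lemma free_gen_mem_free_algebra [simp]: "free_gen g \<in> carrier (free_algebra G) \<longleftrightarrow> g \<in> G"
  by (simp add: mem_free_algebra free_gen_def)

lemma rng_algebra_free_algebra: "rng_algebra (free_algebra G)"
proof (rule rng_algebra.intro)
  show "abelian_group (free_algebra G)"
  proof (rule abelian_groupI)
    fix x assume "x \<in> carrier (free_algebra G)"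
    then show "\<exists>y\<in>carrier (free_algebra G). y \<oplus>\<^bsub>free_algebra G\<^esub> x = \<zero>\<^bsub>free_algebra G\<^esub>"
      by (intro bexI[of _ "- x"]) (auto intro: free_algebra_closed)
  qed (auto intro: free_algebra_closed simp: add_ac)
  show "rng_algebra_axioms (free_algebra G)"
    by standard (auto intro: free_algebra_closed
        simp: algebra_simps single_zero_commute, simp flip: mult.assoc add: single_zero_commute)
qed

lemma minus_free_algebra:
  assumes "x \<in> carrier (free_algebra G)" "y \<in> carrier (free_algebra G)"
  shows "x \<ominus>\<^bsub>free_algebra G\<^esub> y = x - y"
proof -
  interpret rng_algebra "free_algebra G"
    by (rule rng_algebra_free_algebra)
  have "\<ominus>\<^bsub>free_algebra G\<^esub> y = - y"
    using assms by (intro minus_equality) (auto intro: free_algebra_closed)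
  then show ?thesis
    by (simp add: minus_eq)
qed

lemma single_FWord_Cons:
  "Poly_Mapping.single (FWord (a # as)) (c::'k::field) = free_gen a * Poly_Mapping.single (FWord as) c"
  by (simp add: free_gen_def mult_single plus_free_word_def)

lemma single_FWord_single:
  "Poly_Mapping.single (FWord [a]) (c::'k::field) = Poly_Mapping.single 0 c * free_gen a"
  by (simp add: free_gen_def mult_single)

text \<open>A nonempty word is a product of its letters, peeled off from the left. There is no empty
  word to carry the coefficient, so it stays with the last letter, where \<open>smult\<close>
  absorbs it.\<close>

lemma free_algebra_induct [consumes 1, case_names zero gen add smult mult]:
  assumes p: "p \<in> carrier (free_algebra G)"
    and zero: "P 0"
    and gen: "\<And>g. g \<in> G \<Longrightarrow> P (free_gen g)"
    and add: "\<And>p q. p \<in> carrier (free_algebra G) \<Longrightarrow> q \<in> carrier (free_algebra G) \<Longrightarrow>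
      P p \<Longrightarrow> P q \<Longrightarrow> P (p + q)"
    and smult: "\<And>p c. p \<in> carrier (free_algebra G) \<Longrightarrow> P p \<Longrightarrow> P (Poly_Mapping.single 0 c * p)"
    and mult: "\<And>p q. p \<in> carrier (free_algebra G) \<Longrightarrow> q \<in> carrier (free_algebra G) \<Longrightarrow>
      P p \<Longrightarrow> P q \<Longrightarrow> P (p * q)"
  shows "P p"
proof -
  have word: "P (Poly_Mapping.single (FWord as) c) \<and>
      Poly_Mapping.single (FWord as) c \<in> carrier (free_algebra G)"
    if "as \<noteq> []" "set as \<subseteq> G" for as c
    using that
  proof (induction as rule: list_nonempty_induct)
    case (single a)
    then show ?case
      by (auto simp: single_FWord_single intro!: smult gen free_algebra_closed)
  next
    case (cons a as)
    then show ?case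
      by (auto simp: single_FWord_Cons[of a as] intro!: mult gen free_algebra_closed)
  qed
  have "P p \<and> p \<in> carrier (free_algebra G)"
  proof (induction p rule: poly_mapping_single_induct)
    case (single w c)
    then show ?case
      using p word[of "letters w" c] by (simp add: mem_free_algebra)
  qed (auto intro: zero add free_algebra_closed)
  then show ?thesis ..
qed

text \<open>The uniqueness half of the universal property; the uniqueness of
  \<open>canonical_iso\<close> rests on it.\<close>

lemma algebra_hom_free_algebra_eqI:
  assumes f: "f \<in> algebra_hom (free_algebra G) B" and g: "g \<in> algebra_hom (free_algebra G) B"
    and B: "rng_algebra B"
    and gen: "\<And>a. a \<in> G \<Longrightarrow> f (free_gen a) = g (free_gen a)"
    and p: "p \<in> carrier (free_algebra G)"
  shows "f p = g p"
  using p
proof (induction p rule: free_algebra_induct)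
  case zero
  then show ?case
    using algebra_hom_zero[OF rng_algebra_free_algebra B] f g by (metis zero_free_algebra)
next
  case (smult p c)
  then show ?case
    using algebra_homD(4)[OF f, of p c] algebra_homD(4)[OF g, of p c] by simp
next
  case (add p q)
  then show ?case
    using algebra_homD(2)[OF f, of p q] algebra_homD(2)[OF g, of p q] by simp
next
  case (mult p q)
  then show ?case
    using algebra_homD(3)[OF f, of p q] algebra_homD(3)[OF g, of p q] by simp
qed (rule gen)

section \<open>Deletion of words, that is, substituting zero for the generators outside
  \<open>G\<close>\<close>

definition restrict_words ::
  "'g set \<Rightarrow> ('g free_word \<Rightarrow>\<^sub>0 'k::field) \<Rightarrow> ('g free_word \<Rightarrow>\<^sub>0 'k)" where
  "restrict_words G p =
     Abs_poly_mapping (\<lambda>w. if set (letters w) \<subseteq> G then Poly_Mapping.lookup p w else 0)"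

lemma lookup_restrict_words: "Poly_Mapping.lookup (restrict_words G p) w =
    (if set (letters w) \<subseteq> G then Poly_Mapping.lookup p w else 0)"
proof -
  have "finite {w. (if set (letters w) \<subseteq> G then Poly_Mapping.lookup p w else 0) \<noteq> 0}"
    by (rule finite_subset[OF _ finite_keys[of p]]) (auto simp: in_keys_iff)
  then show ?thesis
    by (simp add: restrict_words_def)
qed

lemma restrict_words_zero [simp]: "restrict_words G 0 = 0"
  and restrict_words_add: "restrict_words G (p + q) = restrict_words G p + restrict_words G q"
  and restrict_words_diff: "restrict_words G (p - q) = restrict_words G p - restrict_words G q"
  by (rule poly_mapping_eqI; simp add: lookup_restrict_words lookup_add lookup_minus)+

lemma restrict_words_sum: "restrict_words G (sum f S) = (\<Sum>i\<in>S. restrict_words G (f i))"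
  by (induction S rule: infinite_finite_induct) (simp_all add: restrict_words_add)

lemma restrict_words_single: "restrict_words G (Poly_Mapping.single w c) =
    (if set (letters w) \<subseteq> G then Poly_Mapping.single w c else 0)"
  by (rule poly_mapping_eqI) (auto simp: lookup_restrict_words lookup_single when_def)

lemma restrict_words_free_gen: "restrict_words G (free_gen g) = (if g \<in> G then free_gen g else 0)"
  by (simp add: free_gen_def restrict_words_single)

text \<open>A concatenation has all its letters in \<open>G\<close> exactly when both factors do,
  which settles monomials; the rest is bilinearity.\<close>

lemma restrict_words_mult: "restrict_words G (p * q) = restrict_words G p * restrict_words G q"
proof (induction p rule: poly_mapping_single_induct)
  case (single u c)
  show ?case
    by (induction q rule: poly_mapping_single_induct)
      (auto simp: mult_single restrict_words_single plus_free_word_def distrib_left restrict_words_add)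
qed (simp_all add: distrib_right restrict_words_add)

lemma restrict_words_id: "p \<in> carrier (free_algebra G) \<Longrightarrow> restrict_words G p = p"
  by (rule poly_mapping_eqI) (auto simp: lookup_restrict_words mem_free_algebra in_keys_iff)

lemma restrict_words_mem:
  "p \<in> carrier (free_algebra G') \<Longrightarrow> restrict_words G p \<in> carrier (free_algebra G)"
  by (auto simp: lookup_restrict_words mem_free_algebra in_keys_iff split: if_splits)

lemma restrict_words_restrict_words:
  "restrict_words G (restrict_words G' p) = restrict_words (G \<inter> G') p"
  by (rule poly_mapping_eqI) (auto simp: lookup_restrict_words)

lemma restrict_words_hom:
  "restrict_words G \<in> algebra_hom (free_algebra G') (free_algebra G)"
  by (auto simp: algebra_hom_def restrict_words_mem restrict_words_add restrict_words_mult
      restrict_words_single zero_free_word_def)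

section \<open>Vertices are nonzero in the Leavitt path algebra\<close>

definition linear_action :: "('g \<Rightarrow> ('x \<Rightarrow> 'k::field) \<Rightarrow> 'x \<Rightarrow> 'k) \<Rightarrow> bool" where
  "linear_action T \<longleftrightarrow>
     (\<forall>g f h. T g (\<lambda>x. f x + h x) = (\<lambda>x. T g f x + T g h x)) \<and>
     (\<forall>g c f. T g (\<lambda>x. c * f x) = (\<lambda>x. c * T g f x))"

text \<open>The module of all functions on \<open>'x\<close>, each generator acting through
  \<open>T\<close>. With \<open>foldr\<close> the leftmost letter acts last, so that a product acts
  as a composition.\<close>

definition act ::
  "('g \<Rightarrow> ('x \<Rightarrow> 'k::field) \<Rightarrow> 'x \<Rightarrow> 'k) \<Rightarrow> ('g free_word \<Rightarrow>\<^sub>0 'k) \<Rightarrow> ('x \<Rightarrow> 'k) \<Rightarrow> 'x \<Rightarrow> 'k"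
  where "act T p f x =
    (\<Sum>w\<in>Poly_Mapping.keys p. Poly_Mapping.lookup p w * foldr T (letters w) f x)"

lemma act_superset:
  assumes "finite S" "Poly_Mapping.keys p \<subseteq> S"
  shows "act T p f x = (\<Sum>w\<in>S. Poly_Mapping.lookup p w * foldr T (letters w) f x)"
  unfolding act_def using assms by (intro sum.mono_neutral_left) (auto simp: in_keys_iff)

lemma act_zero [simp]: "act T 0 f x = 0"
  by (simp add: act_def)

lemma act_single: "act T (Poly_Mapping.single w c) f x = c * foldr T (letters w) f x"
  by (simp add: act_superset[of "{w}"])

lemma act_add: "act T (p + q) f x = act T p f x + act T q f x"
proof -
  let ?S = "Poly_Mapping.keys p \<union> Poly_Mapping.keys q"
  show ?thesis
    using Poly_Mapping.keys_add[of p q]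
    by (simp add: act_superset[of ?S] lookup_add distrib_right sum.distrib)
qed

lemma act_diff: "act T (p - q) f x = act T p f x - act T q f x"
  using act_add[of T "p - q" q f x] by simp

lemma act_sum: "act T (sum p S) f x = (\<Sum>i\<in>S. act T (p i) f x)"
  by (induction S rule: infinite_finite_induct) (simp_all add: act_add)

lemma act_free_gen [simp]: "act T (free_gen g) f = T g f"
  by (rule ext) (simp add: free_gen_def act_single)

context
  fixes T :: "'g \<Rightarrow> ('x \<Rightarrow> 'k::field) \<Rightarrow> 'x \<Rightarrow> 'k"
  assumes T: "linear_action T"
begin

lemma foldr_linear:
  "foldr T as (\<lambda>x. f x + h x) = (\<lambda>x. foldr T as f x + foldr T as h x)"
  "foldr T as (\<lambda>x. c * f x) = (\<lambda>x. c * foldr T as f x)"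
  using T by (induction as) (simp_all add: linear_action_def)

lemma act_arg_add: "act T p (\<lambda>x. f x + h x) = (\<lambda>x. act T p f x + act T p h x)"
  by (rule ext) (simp add: act_def foldr_linear distrib_left sum.distrib)

lemma act_arg_zero: "act T p (\<lambda>x. 0) = (\<lambda>x. 0)"
proof -
  have "foldr T as (\<lambda>x. 0) = (\<lambda>x. 0)" for as
    using foldr_linear(2)[of as 0 "\<lambda>x. 0"] by simp
  then show ?thesis
    by (intro ext) (simp add: act_def)
qed

lemma act_mult: "act T (p * q) f = act T p (act T q f)"
proof (induction p rule: poly_mapping_single_induct)
  case (single u c)
  show ?case
  proof (induction q rule: poly_mapping_single_induct)
    case (single v d)
    have eq: "act T (Poly_Mapping.single v d) f = (\<lambda>x. d * foldr T (letters v) f x)"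
      by (rule ext) (simp add: act_single)
    show ?case
      by (rule ext) (simp add: mult_single act_single eq foldr_linear plus_free_word_def)
  next
    case (add q r)
    have eq: "act T (q + r) f = (\<lambda>x. act T q f x + act T r f x)"
      by (rule ext) (simp add: act_add)
    show ?case
      by (rule ext) (simp add: distrib_left act_add eq act_arg_add add)
  next
    case zero
    have "act T 0 f = (\<lambda>x. 0)"
      by (rule ext) simp
    then show ?case
      by (simp add: act_arg_zero)
  qed
qed (rule ext; simp add: distrib_right act_add)+

text \<open>The annihilator of a module is an ideal. Hence a module killed by the relators is killed
  by the whole relation ideal.\<close>

lemma algebra_ideal_act_kernel:
  "algebra_ideal {p \<in> carrier (free_algebra G). \<forall>f x. act T p f x = 0} (free_algebra G)"
    (is "algebra_ideal ?N _")
proof -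
  interpret rng_algebra "free_algebra G"
    by (rule rng_algebra_free_algebra)
  have zero: "act T p f = (\<lambda>x. 0)" if "p \<in> ?N" for p f
    using that by (intro ext) simp
  have mult: "act T (p * q) f x = 0" "act T (q * p) f x = 0" if "p \<in> ?N" for p q f x
    using that by (simp_all add: act_mult zero[OF that] act_arg_zero)
  have "two_sided_ideal ?N (free_algebra G)"
  proof (rule two_sided_idealI)
    fix x assume x: "x \<in> ?N"
    then have "\<ominus>\<^bsub>free_algebra G\<^esub> x = 0 - x"
      using minus_free_algebra[of 0 G x] by (simp add: minus_eq)
    then show "\<ominus>\<^bsub>free_algebra G\<^esub> x \<in> ?N"
      using x by (auto simp: act_diff intro: free_algebra_closed simp del: diff_0)
  qed (auto simp: act_add mult intro: free_algebra_closed)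
  then show ?thesis
    by (auto simp: algebra_ideal_def mult intro: free_algebra_closed)
qed

end

section \<open>A representation of the Leavitt path algebra\<close>

lemma lpa_relators_subset:
  "(lpa_relators E :: ('v, 'e, 'k::field) free_elem set) \<subseteq> carrier (free_algebra (lpa_gens E))"
  if "wf_digraph E"
proof -
  interpret wf_digraph E by fact
  show ?thesis
    unfolding lpa_relators_def
    by (auto intro!: free_algebra_closed sum_mem_free_algebra
        simp: lpa_gens_def regular_vertex_def)
qed

text \<open>
  The representation has basis \<open>E\<^sup>0 \<times> \<nat>\<close>; for regular \<open>v\<close> the block of \<open>v\<close> is matched by
  \<open>\<beta> v\<close> with the disjoint union of the blocks of \<open>r(e)\<close>, \<open>s(e) = v\<close>.
\<close>

fun branching_action :: "('v, 'e) pre_digraph \<Rightarrow> ('v \<Rightarrow> nat \<Rightarrow> 'e \<times> nat) \<Rightarrow>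
    ('v, 'e) lpa_gen \<Rightarrow> ('v \<times> nat \<Rightarrow> 'k::field) \<Rightarrow> 'v \<times> nat \<Rightarrow> 'k" where
  "branching_action E \<beta> (Vert v) f (u, n) = (if u = v then f (u, n) else 0)"
| "branching_action E \<beta> (Edge e) f (u, n) =
     (if u = tail E e \<and> fst (\<beta> u n) = e then f (head E e, snd (\<beta> u n)) else 0)"
| "branching_action E \<beta> (Ghost e) f (u, n) =
     (if u = head E e then f (tail E e, inv_into UNIV (\<beta> (tail E e)) (e, n)) else 0)"

lemma linear_action_branching:
  fixes E :: "('v, 'e) pre_digraph"
  shows "linear_action (branching_action E \<beta>)"
  unfolding linear_action_def
proof (intro conjI allI ext)
  fix g f h c and x :: "'v \<times> nat"
  show "branching_action E \<beta> g (\<lambda>x. f x + h x) x =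
      branching_action E \<beta> g f x + branching_action E \<beta> g h x"
    by (cases g; cases x) auto
  show "branching_action E \<beta> g (\<lambda>x. c * f x) x = c * branching_action E \<beta> g f x"
    by (cases g; cases x) auto
qed

text \<open>Vertices project onto their blocks; an edge and its ghost move values along
  \<open>\<beta>\<close> and its inverse. The bijection at the source of an edge makes ghost after
  edge the projection at the range, and a ghost meets no foreign edge because \<open>\<beta>\<close>
  records the edge. Row-finiteness makes every source regular, which is where \<open>\<beta>\<close>
  is constrained.\<close>

lemma act_lpa_relators:
  assumes \<beta>: "\<And>v. regular_vertex E v \<Longrightarrow> bij_betw (\<beta> v) UNIV (out_arcs E v \<times> UNIV)"
    and E: "row_finite E"
    and p: "p \<in> (lpa_relators E :: ('v, 'e, 'k::field) free_elem set)"
  shows "act (branching_action E \<beta>) p f (u, n) = 0"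
proof -
  let ?T = "branching_action E \<beta>"
  note T = act_mult[OF linear_action_branching[of E \<beta>]]
  have reg: "regular_vertex E (tail E e)" if "e \<in> arcs E" for e
    using that E wf_digraph.tail_in_verts[of E e]
    by (auto simp: regular_vertex_def row_finite_def)
  have inv1: "inv_into UNIV (\<beta> v) (\<beta> v n) = n" if "regular_vertex E v" for v n
    using \<beta>[OF that] by (simp add: bij_betw_def)
  have inv2: "\<beta> (tail E e) (inv_into UNIV (\<beta> (tail E e)) (e, n)) = (e, n)" if "e \<in> arcs E" for e n
    using \<beta>[OF reg[OF that]] that by (intro f_inv_into_f) (auto simp: bij_betw_def)
  have mem: "fst (\<beta> v n) \<in> out_arcs E v" if "regular_vertex E v" for v n
    using \<beta>[OF that] by (metis bij_betwE iso_tuple_UNIV_I mem_Times_iff)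
  have "(\<Sum>e\<in>out_arcs E v. act ?T (free_gen (Edge e) * free_gen (Ghost e)) f (u, n)) =
      ?T (Vert v) f (u, n)" if v: "regular_vertex E v" for v
  proof -
    \<comment> \<open>The index \<open>n\<close> in the block of \<open>v\<close> is matched with
      the block of exactly one edge, namely \<open>fst (\<beta> v n)\<close>; all other summands
      vanish.\<close>
    have "(\<Sum>e\<in>out_arcs E v. act ?T (free_gen (Edge e) * free_gen (Ghost e)) f (u, n)) =
        (\<Sum>e\<in>out_arcs E v. if e = fst (\<beta> v n) then (if u = v then f (u, n) else 0) else 0)"
    proof (rule sum.cong[OF refl])
      fix e assume "e \<in> out_arcs E v"
      then have "tail E e = v"
        by simp
      then show "act ?T (free_gen (Edge e) * free_gen (Ghost e)) f (u, n) =
          (if e = fst (\<beta> v n) then (if u = v then f (u, n) else 0) else 0)"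
        using inv1[OF v] by (auto simp: T)
    qed
    also have "\<dots> = ?T (Vert v) f (u, n)"
      using v mem[OF v, of n] by (simp add: regular_vertex_def)
    finally show ?thesis .
  qed
  then show ?thesis
    using p unfolding lpa_relators_def
    by (auto simp: act_diff act_sum T inv2)
qed

text \<open>A regular vertex emits at least one and only finitely many edges, so the disjoint union
  of their blocks is again countably infinite. Finite blocks would impose dimension conditions along
  the graph.\<close>

lemma ex_branching:
  assumes "regular_vertex E v"
  shows "\<exists>b :: nat \<Rightarrow> 'e \<times> nat. bij_betw b UNIV (out_arcs E v \<times> UNIV)"
proof -
  have "infinite (out_arcs E v \<times> (UNIV :: nat set))" "countable (out_arcs E v \<times> (UNIV :: nat set))"
    using assms by (auto simp: regular_vertex_def finite_cartesian_product_iff intro: countable_finite)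
  then show ?thesis
    using bij_betw_from_nat_into by blast
qed

theorem Vert_notin_lpa_rel_ideal:
  assumes E: "row_finite E" and v: "v \<in> verts E"
  shows "free_gen (Vert v) \<notin> (lpa_rel_ideal E :: ('v, 'e, 'k::field) free_elem set)"
proof
  assume mem: "free_gen (Vert v) \<in> (lpa_rel_ideal E :: ('v, 'e, 'k) free_elem set)"
  obtain \<beta> :: "'v \<Rightarrow> nat \<Rightarrow> 'e \<times> nat"
    where \<beta>: "\<And>v. regular_vertex E v \<Longrightarrow> bij_betw (\<beta> v) UNIV (out_arcs E v \<times> UNIV)"
    using ex_branching by metis
  let ?T = "branching_action E \<beta> :: _ \<Rightarrow> ('v \<times> nat \<Rightarrow> 'k) \<Rightarrow> _"
  have "lpa_rel_ideal E \<subseteq> {p \<in> carrier (free_algebra (lpa_gens E)). \<forall>f x. act ?T p f x = 0}"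
    unfolding lpa_rel_ideal_def
  proof (rule algebra_ideal_gen_least[OF algebra_ideal_act_kernel[OF linear_action_branching]])
    show "lpa_relators E \<subseteq> {p \<in> carrier (free_algebra (lpa_gens E)). \<forall>f x. act ?T p f x = 0}"
      using act_lpa_relators[OF \<beta> E] lpa_relators_subset[of E] E
      by (auto simp: row_finite_def)
  qed
  \<comment> \<open>The vertex acts as the projection onto its own block, so the constant function 1
    keeps the value 1 at \<open>(v, 0)\<close>.\<close>
  then have "act ?T (free_gen (Vert v)) (\<lambda>_. 1) (v, 0) = 0"
    using mem by blast
  then show False
    by simp
qed

section \<open>Quotient graphs\<close>

lemma quotient_graph_simps [simp]:
  "verts (quotient_graph E X) = verts E - X"
  "arcs (quotient_graph E X) = {e \<in> arcs E. head E e \<notin> X}"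
  "tail (quotient_graph E X) = tail E" "head (quotient_graph E X) = head E"
  by (simp_all add: quotient_graph_def)

lemma quotient_graph_quotient_graph:
  "quotient_graph (quotient_graph E X) Y = quotient_graph E (X \<union> Y)"
  by (auto simp: quotient_graph_def)

lemma out_arcs_quotient_graph:
  "out_arcs (quotient_graph E X) v = {e \<in> out_arcs E v. head E e \<notin> X}"
  by (auto simp: out_arcs_def)

lemma finite_out_arcs_quotient_graph:
  "finite (out_arcs E v) \<Longrightarrow> finite (out_arcs (quotient_graph E X) v)"
  by (rule finite_subset[of _ "out_arcs E v"]) auto

lemma hereditary_iff:
  assumes "wf_digraph E"
  shows "hereditary E X \<longleftrightarrow> X \<subseteq> verts E \<and> (\<forall>e\<in>arcs E. tail E e \<in> X \<longrightarrow> head E e \<in> X)"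
proof -
  interpret wf_digraph E by fact
  have "head E e \<in> X" if "hereditary E X" "e \<in> arcs E" "tail E e \<in> X" for e
  proof -
    have "tail E e \<rightarrow>\<^sup>*\<^bsub>E\<^esub> head E e"
      using that(2) by (intro reachable_adjI in_arcs_imp_in_arcs_ends)
    then show ?thesis
      using that by (auto simp: hereditary_def)
  qed
  moreover have "w \<in> X" if "v \<rightarrow>\<^sup>*\<^bsub>E\<^esub> w" "v \<in> X" "\<forall>e\<in>arcs E. tail E e \<in> X \<longrightarrow> head E e \<in> X" for v w
    using that by (induction rule: reachable_induct) (auto simp: arcs_ends_def arc_to_ends_def)
  ultimately show ?thesis
    by (auto simp: hereditary_def)
qed

lemma row_finite_quotient_graph:
  assumes "row_finite E" "hereditary E X"
  shows "row_finite (quotient_graph E X)"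
proof -
  have wf: "wf_digraph E"
    using assms by (simp add: row_finite_def)
  have "wf_digraph (quotient_graph E X)"
    using wf assms(2) unfolding hereditary_iff[OF wf]
    by unfold_locales (auto simp: wf_digraph.tail_in_verts wf_digraph.head_in_verts)
  then show ?thesis
    using assms(1) by (simp add: row_finite_def finite_out_arcs_quotient_graph)
qed

text \<open>For saturation, a vertex whose edges all end in \<open>X\<close> lies in
  \<open>X\<close>. A vertex outside \<open>X\<close> with some edge ending elsewhere is still
  regular in the quotient, where its remaining edges end in \<open>Y\<close>, so that saturation of
  \<open>Y\<close> applies.\<close>

lemma hereditary_saturated_Un:
  assumes E: "row_finite E" and X: "hereditary E X" "saturated E X"
    and Y: "hereditary (quotient_graph E X) Y" "saturated (quotient_graph E X) Y"
  shows "hereditary E (X \<union> Y)" "saturated E (X \<union> Y)"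
proof -
  have wf: "wf_digraph E" and wf': "wf_digraph (quotient_graph E X)"
    using E row_finite_quotient_graph[OF E X(1)] by (simp_all add: row_finite_def)
  show "hereditary E (X \<union> Y)"
    using X(1) Y(1) unfolding hereditary_iff[OF wf] hereditary_iff[OF wf'] by auto
  have sub: "X \<union> Y \<subseteq> verts E"
    using X Y by (auto simp: hereditary_def)
  have "v \<in> X \<union> Y" if v: "regular_vertex E v" "head E ` out_arcs E v \<subseteq> X \<union> Y" for v
  proof (cases "head E ` out_arcs E v \<subseteq> X")
    case True
    then show ?thesis
      using X(2) v by (auto simp: saturated_def)
  next
    case False
    show ?thesis
    proof (cases "v \<in> X")
      case v': False
      have "regular_vertex (quotient_graph E X) v"
        using v v' False finite_out_arcs_quotient_graph[of E v X]
        by (auto simp: regular_vertex_def)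
      moreover have "head E ` out_arcs (quotient_graph E X) v \<subseteq> Y"
        using v(2) by (auto simp: image_subset_iff)
      ultimately show ?thesis
        using Y(2) by (auto simp: saturated_def)
    qed simp
  qed
  then show "saturated E (X \<union> Y)"
    using sub by (simp add: saturated_def)
qed

lemma lpa_gens_simps [simp]:
  "Vert v \<in> lpa_gens E \<longleftrightarrow> v \<in> verts E"
  "Edge e \<in> lpa_gens E \<longleftrightarrow> e \<in> arcs E"
  "Ghost e \<in> lpa_gens E \<longleftrightarrow> e \<in> arcs E"
  by (auto simp: lpa_gens_def)

lemma lpa_gens_quotient_graph_subset: "lpa_gens (quotient_graph E X) \<subseteq> lpa_gens E"
  by (auto simp: lpa_gens_def)

lemma lpa_gens_quotient_graph_Int:
  "lpa_gens (quotient_graph E (X \<union> Y)) \<inter> lpa_gens (quotient_graph E X) =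
    lpa_gens (quotient_graph E (X \<union> Y))"
  by (auto simp: lpa_gens_def)


section \<open>The Leavitt path algebra as a quotient\<close>

lemma lpa_relators_intros:
  "v \<in> verts E \<Longrightarrow> w \<in> verts E \<Longrightarrow>
    free_gen (Vert v) * free_gen (Vert w) - (if v = w then free_gen (Vert v) else 0) \<in> lpa_relators E"
  "e \<in> arcs E \<Longrightarrow>
    free_gen (Vert (tail E e)) * free_gen (Edge e) - free_gen (Edge e) \<in> lpa_relators E"
  "e \<in> arcs E \<Longrightarrow>
    free_gen (Edge e) * free_gen (Vert (head E e)) - free_gen (Edge e) \<in> lpa_relators E"
  "e \<in> arcs E \<Longrightarrow>
    free_gen (Vert (head E e)) * free_gen (Ghost e) - free_gen (Ghost e) \<in> lpa_relators E"
  "e \<in> arcs E \<Longrightarrow>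
    free_gen (Ghost e) * free_gen (Vert (tail E e)) - free_gen (Ghost e) \<in> lpa_relators E"
  "e \<in> arcs E \<Longrightarrow> f \<in> arcs E \<Longrightarrow>
    free_gen (Ghost e) * free_gen (Edge f) - (if e = f then free_gen (Vert (head E e)) else 0)
      \<in> lpa_relators E"
  "regular_vertex E v \<Longrightarrow>
    free_gen (Vert v) - (\<Sum>e\<in>out_arcs E v. free_gen (Edge e) * free_gen (Ghost e)) \<in> lpa_relators E"
  unfolding lpa_relators_def by blast+

lemma lpa_relators_cases:
  assumes "p \<in> lpa_relators E"
  obtains
    (vert_vert) v w where "v \<in> verts E" "w \<in> verts E"
      "p = free_gen (Vert v) * free_gen (Vert w) - (if v = w then free_gen (Vert v) else 0)"
  | (tail_edge) e where "e \<in> arcs E"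
      "p = free_gen (Vert (tail E e)) * free_gen (Edge e) - free_gen (Edge e)"
  | (edge_head) e where "e \<in> arcs E"
      "p = free_gen (Edge e) * free_gen (Vert (head E e)) - free_gen (Edge e)"
  | (head_ghost) e where "e \<in> arcs E"
      "p = free_gen (Vert (head E e)) * free_gen (Ghost e) - free_gen (Ghost e)"
  | (ghost_tail) e where "e \<in> arcs E"
      "p = free_gen (Ghost e) * free_gen (Vert (tail E e)) - free_gen (Ghost e)"
  | (ck1) e f where "e \<in> arcs E" "f \<in> arcs E"
      "p = free_gen (Ghost e) * free_gen (Edge f) - (if e = f then free_gen (Vert (head E e)) else 0)"
  | (ck2) v where "regular_vertex E v"
      "p = free_gen (Vert v) - (\<Sum>e\<in>out_arcs E v. free_gen (Edge e) * free_gen (Ghost e))"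
  using assms unfolding lpa_relators_def by (elim UnE CollectE exE conjE) blast+

definition lpa_proj ::
  "('v, 'e) pre_digraph \<Rightarrow> ('v, 'e, 'k::field) free_elem \<Rightarrow> ('v, 'e, 'k) free_elem set" where
  "lpa_proj E p = lpa_rel_ideal E +>\<^bsub>free_algebra (lpa_gens E)\<^esub> p"

lemma lpa_elem_eq: "lpa_elem E g = lpa_proj E (free_gen g)"
  by (simp add: lpa_elem_def lpa_proj_def)

context
  fixes E :: "('v, 'e) pre_digraph"
  assumes wf: "wf_digraph E"
begin

lemma algebra_ideal_lpa_rel_ideal:
  "algebra_ideal (lpa_rel_ideal E :: ('v, 'e, 'k::field) free_elem set) (free_algebra (lpa_gens E))"
proof -
  interpret rng_algebra "free_algebra (lpa_gens E) :: ('k, ('v, 'e, 'k) free_elem) module"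
    by (rule rng_algebra_free_algebra)
  show ?thesis
    unfolding lpa_rel_ideal_def by (rule algebra_ideal_gen[OF lpa_relators_subset[OF wf]])
qed

lemma lpa_rel_ideal_closed:
  fixes p q :: "('v, 'e, 'k::field) free_elem"
  shows "(0 :: ('v, 'e, 'k) free_elem) \<in> lpa_rel_ideal E"
    and "p \<in> lpa_rel_ideal E \<Longrightarrow> p \<in> carrier (free_algebra (lpa_gens E))"
    and "p \<in> lpa_rel_ideal E \<Longrightarrow> q \<in> lpa_rel_ideal E \<Longrightarrow> p + q \<in> lpa_rel_ideal E"
proof -
  interpret rng_algebra "free_algebra (lpa_gens E) :: ('k, ('v, 'e, 'k) free_elem) module"
    by (rule rng_algebra_free_algebra)
  have "two_sided_ideal (lpa_rel_ideal E :: ('v, 'e, 'k) free_elem set) (free_algebra (lpa_gens E))"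
    using algebra_ideal_lpa_rel_ideal[where ?'k = 'k] unfolding algebra_ideal_def by blast
  note I = two_sided_idealD[OF this]
  show "(0 :: ('v, 'e, 'k) free_elem) \<in> lpa_rel_ideal E" "p \<in> lpa_rel_ideal E \<Longrightarrow> p \<in> carrier (free_algebra (lpa_gens E))"
    "p \<in> lpa_rel_ideal E \<Longrightarrow> q \<in> lpa_rel_ideal E \<Longrightarrow> p + q \<in> lpa_rel_ideal E"
    using I(1,2) I(3)[of p q] by auto
qed

lemma rng_algebra_lpa: "rng_algebra (lpa E)"
  unfolding lpa_def by (rule rng_algebra_quot_algebra[OF rng_algebra_free_algebra algebra_ideal_lpa_rel_ideal])

lemma lpa_proj_hom: "lpa_proj E \<in> algebra_hom (free_algebra (lpa_gens E)) (lpa E)"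
  unfolding lpa_def lpa_proj_def
  by (rule quot_algebra_hom[OF rng_algebra_free_algebra algebra_ideal_lpa_rel_ideal])

lemma lpa_proj_surj: "lpa_proj E ` carrier (free_algebra (lpa_gens E)) = carrier (lpa E)"
  unfolding lpa_def lpa_proj_def
  by (rule carrier_quot_algebra[OF rng_algebra_free_algebra algebra_ideal_lpa_rel_ideal, symmetric])

lemma lpa_proj_eq_iff:
  assumes "p \<in> carrier (free_algebra (lpa_gens E))" "q \<in> carrier (free_algebra (lpa_gens E))"
  shows "lpa_proj E p = lpa_proj E q \<longleftrightarrow> p - q \<in> lpa_rel_ideal E"
  unfolding lpa_proj_def
  using coset_eq_iff[OF rng_algebra_free_algebra algebra_ideal_lpa_rel_ideal assms] assms
  by (simp add: minus_free_algebra)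

lemma lpa_proj_diff:
  fixes p q :: "('v, 'e, 'k::field) free_elem"
  assumes "p \<in> carrier (free_algebra (lpa_gens E))" "q \<in> carrier (free_algebra (lpa_gens E))"
  shows "lpa_proj E p \<ominus>\<^bsub>lpa E\<^esub> lpa_proj E q = lpa_proj E (p - q)"
proof -
  interpret L: rng_algebra "lpa E :: ('k, ('v, 'e, 'k) free_elem set) module"
    by (rule rng_algebra_lpa)
  have pq: "p - q \<in> carrier (free_algebra (lpa_gens E))"
    using assms by (rule free_algebra_closed)
  have "lpa_proj E p = lpa_proj E (p - q) \<oplus>\<^bsub>lpa E\<^esub> lpa_proj E q"
    using algebra_homD(2)[OF lpa_proj_hom pq assms(2)] by simp
  then show ?thesis
    using algebra_homD(1)[OF lpa_proj_hom pq] algebra_homD(1)[OF lpa_proj_hom assms(2)]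
    by (simp add: L.minus_eq L.a_assoc L.r_neg)
qed

lemma lpa_relators_subset_rel_ideal: "lpa_relators E \<subseteq> lpa_rel_ideal E"
  unfolding lpa_rel_ideal_def by (rule subset_algebra_ideal_gen)

text \<open>\<open>vertex_ideal\<close> is generated as a ring ideal, while the quotient
  \<open>lpa_mod\<close> must carry a scalar action. The relation \<open>v v = v\<close> makes the
  generators idempotent, and this yields closure under scalars.\<close>

lemma algebra_ideal_vertex_ideal:
  assumes "Y \<subseteq> verts E"
  shows "algebra_ideal (vertex_ideal E Y :: ('v, 'e, 'k::field) free_elem set set) (lpa E)"
proof -
  interpret L: rng_algebra "lpa E :: ('k, ('v, 'e, 'k) free_elem set) module"
    by (rule rng_algebra_lpa)
  show ?thesis
    unfolding vertex_ideal_def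
  proof (rule L.algebra_ideal_ideal_gen_idem)
    show "(\<lambda>v. lpa_elem E (Vert v)) ` Y \<subseteq> carrier (lpa E :: ('k, ('v, 'e, 'k) free_elem set) module)"
      using assms by (auto simp: lpa_elem_eq intro!: algebra_homD(1)[OF lpa_proj_hom])
    fix s :: "('v, 'e, 'k) free_elem set" assume "s \<in> (\<lambda>v. lpa_elem E (Vert v)) ` Y"
    then obtain v where v: "v \<in> verts E" and s: "s = lpa_proj E (free_gen (Vert v))"
      using assms by (auto simp: lpa_elem_eq)
    have "free_gen (Vert v) \<in> carrier (free_algebra (lpa_gens E) :: ('k, ('v, 'e, 'k) free_elem) module)"
      using v by simp
    from algebra_homD(3)[OF lpa_proj_hom this this]
    have "s \<otimes>\<^bsub>lpa E\<^esub> s = lpa_proj E (free_gen (Vert v) * free_gen (Vert v))"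
      by (simp add: s)
    also have "\<dots> = s"
      unfolding s using v lpa_relators_intros(1)[OF v v] lpa_relators_subset_rel_ideal
      by (subst lpa_proj_eq_iff) (auto intro: free_algebra_closed)
    finally show "s \<otimes>\<^bsub>lpa E\<^esub> s = s" .
  qed
qed

context
  fixes Y :: "'v set"
  assumes Y: "Y \<subseteq> verts E"
begin

lemma lpa_class_hom: "lpa_class E Y \<in> algebra_hom (lpa E) (lpa_mod E Y)"
  unfolding lpa_class_def lpa_mod_def
  by (rule quot_algebra_hom[OF rng_algebra_lpa algebra_ideal_vertex_ideal[OF Y]])

lemma lpa_class_surj: "lpa_class E Y ` carrier (lpa E) = carrier (lpa_mod E Y)"
  unfolding lpa_class_def lpa_mod_def
  by (rule carrier_quot_algebra[OF rng_algebra_lpa algebra_ideal_vertex_ideal[OF Y], symmetric])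

lemma lpa_class_proj_eq_iff:
  assumes "p \<in> carrier (free_algebra (lpa_gens E))" "q \<in> carrier (free_algebra (lpa_gens E))"
  shows "lpa_class E Y (lpa_proj E p) = lpa_class E Y (lpa_proj E q) \<longleftrightarrow>
    lpa_proj E (p - q) \<in> vertex_ideal E Y"
  unfolding lpa_class_def lpa_proj_diff[OF assms, symmetric]
  using assms
  by (intro coset_eq_iff[OF rng_algebra_lpa algebra_ideal_vertex_ideal[OF Y]] algebra_homD(1)[OF lpa_proj_hom])

lemma rng_algebra_lpa_mod: "rng_algebra (lpa_mod E Y)"
  unfolding lpa_mod_def by (rule rng_algebra_quot_algebra[OF rng_algebra_lpa algebra_ideal_vertex_ideal[OF Y]])

lemma algebra_ideal_vertex_ideal_vimage:
  "algebra_ideal {p \<in> carrier (free_algebra (lpa_gens E)). lpa_proj E p \<in> vertex_ideal E Y}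
    (free_algebra (lpa_gens E))"
  by (rule algebra_ideal_vimage[OF rng_algebra_free_algebra rng_algebra_lpa lpa_proj_hom
        algebra_ideal_vertex_ideal[OF Y]])

end

end

lemma vertex_ideal_mono:
  assumes "X \<subseteq> Y"
  shows "vertex_ideal E X \<subseteq> vertex_ideal E Y"
  using assms unfolding vertex_ideal_def ideal_gen_def by blast

section \<open>The canonical isomorphism\<close>

lemma algebra_iso_imp_hom: "f \<in> algebra_iso A B \<Longrightarrow> f \<in> algebra_hom A B"
  by (auto simp: algebra_iso_def rng_iso_def algebra_hom_def bij_betw_def)

context
  fixes E :: "('v, 'e) pre_digraph" and X :: "'v set"
  assumes E: "row_finite E" and X: "hereditary E X" "saturated E X"
begin

private abbreviation "Q \<equiv> quotient_graph E X"
private abbreviation "res \<equiv> restrict_words (lpa_gens Q)"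

private lemma wf: "wf_digraph E"
  using E by (simp add: row_finite_def)

private lemma wfQ: "wf_digraph Q"
  using row_finite_quotient_graph[OF E X(1)] by (simp add: row_finite_def)

private lemma X_subset: "X \<subseteq> verts E"
  using X(1) by (simp add: hereditary_def)

private lemma head_mem: "e \<in> arcs E \<Longrightarrow> tail E e \<in> X \<Longrightarrow> head E e \<in> X"
  using X(1) by (simp add: hereditary_iff[OF wf])

text \<open>Each relator is either deleted completely or becomes a relator of \<open>Q\<close>; no
  proper part of one is left over. Heredity ensures this for the relators that involve the source of
  an edge. In the sum relation at \<open>v\<close>, heredity removes all edges if \<open>v\<close>
  is in \<open>X\<close>. If \<open>v\<close> is not in \<open>X\<close>, saturation retains an
  edge, without which the bare vertex would remain.\<close>

lemma restrict_words_lpa_relators: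
  assumes "p \<in> (lpa_relators E :: ('v, 'e, 'k::field) free_elem set)"
  shows "res p \<in> lpa_rel_ideal Q"
proof -
  note restrict = restrict_words_diff restrict_words_mult restrict_words_free_gen restrict_words_sum
  have tails: "tail E e \<in> verts E" "head E e \<in> verts E" if "e \<in> arcs E" for e
    using that wf by (simp_all add: wf_digraph.tail_in_verts wf_digraph.head_in_verts)
  from assms have "res p \<in> insert 0 (lpa_relators Q)"
  proof (cases rule: lpa_relators_cases)
    case (vert_vert v w)
    then show ?thesis
      using lpa_relators_intros(1)[of v Q w] by (auto simp: restrict)
  next
    case (tail_edge e)
    then show ?thesis
      using lpa_relators_intros(2)[of e Q] head_mem[of e] tails[of e] by (auto simp: restrict)
  next
    case (edge_head e)
    then show ?thesis
      using lpa_relators_intros(3)[of e Q] tails[of e] by (auto simp: restrict)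
  next
    case (head_ghost e)
    then show ?thesis
      using lpa_relators_intros(4)[of e Q] tails[of e] by (auto simp: restrict)
  next
    case (ghost_tail e)
    then show ?thesis
      using lpa_relators_intros(5)[of e Q] head_mem[of e] tails[of e] by (auto simp: restrict)
  next
    case (ck1 e f)
    then show ?thesis
      using lpa_relators_intros(6)[of e Q f] tails[of e] by (auto simp: restrict)
  next
    case (ck2 v)
    have fin: "finite (out_arcs E v)" and v: "v \<in> verts E" "out_arcs E v \<noteq> {}"
      using ck2 by (simp_all add: regular_vertex_def)
    have res: "res p = (if v \<in> X then 0 else free_gen (Vert v)) -
        (\<Sum>e\<in>out_arcs Q v. free_gen (Edge e) * free_gen (Ghost e))"
    proof -
      have "(\<Sum>e\<in>out_arcs E v. res (free_gen (Edge e)) * res (free_gen (Ghost e))) =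
          (\<Sum>e\<in>out_arcs Q v. free_gen (Edge e) * free_gen (Ghost e))"
        using fin by (intro sum.mono_neutral_cong_right) (auto simp: restrict)
      then show ?thesis
        using ck2 v by (simp add: restrict_words_diff restrict_words_sum restrict_words_mult)
          (simp add: restrict_words_free_gen)
    qed
    show ?thesis
    proof (cases "v \<in> X")
      case True
      then have "out_arcs Q v = {}"
        using head_mem by auto
      then show ?thesis
        using True res by simp
    next
      case False
      then have "out_arcs Q v \<noteq> {}"
        using X(2) ck2 by (auto simp: saturated_def out_arcs_quotient_graph)
      then have "regular_vertex Q v"
        using v False finite_out_arcs_quotient_graph[OF fin] by (simp add: regular_vertex_def)
      then show ?thesis
        using False res by (simp add: lpa_relators_intros(7))
    qed
  qed
  then show ?thesis
    by (auto simp: lpa_rel_ideal_closed(1)[OF wfQ] subsetD[OF lpa_relators_subset_rel_ideal[OF wfQ]])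
qed

section \<open>The preimage of \<open>I(X)\<close> in the free algebra\<close>

private abbreviation lifted_ideal :: "('v, 'e, 'k::field) free_elem set" where
  "lifted_ideal \<equiv> {p \<in> carrier (free_algebra (lpa_gens E)). lpa_proj E p \<in> vertex_ideal E X}"

private lemma lifted_ideal_closed:
  fixes p q :: "('v, 'e, 'k::field) free_elem"
  shows "p \<in> lifted_ideal \<Longrightarrow> q \<in> lifted_ideal \<Longrightarrow> p + q \<in> lifted_ideal"
    and "p \<in> lifted_ideal \<Longrightarrow> q \<in> lifted_ideal \<Longrightarrow> p - q \<in> lifted_ideal"
    and "p \<in> lifted_ideal \<Longrightarrow> q \<in> carrier (free_algebra (lpa_gens E)) \<Longrightarrow> p * q \<in> lifted_ideal"
    and "q \<in> lifted_ideal \<Longrightarrow> p \<in> carrier (free_algebra (lpa_gens E)) \<Longrightarrow> p * q \<in> lifted_ideal"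
    and "p \<in> lifted_ideal \<Longrightarrow> Poly_Mapping.single 0 c * p \<in> lifted_ideal"
    and "p \<in> lpa_rel_ideal E \<Longrightarrow> p \<in> lifted_ideal"
    and "(0 :: ('v, 'e, 'k) free_elem) \<in> lifted_ideal"
proof -
  interpret F: rng_algebra "free_algebra (lpa_gens E) :: ('k, ('v, 'e, 'k) free_elem) module"
    by (rule rng_algebra_free_algebra)
  have ideal: "algebra_ideal (lifted_ideal :: ('v, 'e, 'k) free_elem set) (free_algebra (lpa_gens E))"
    by (rule algebra_ideal_vertex_ideal_vimage[OF wf X_subset])
  then have two_sided: "two_sided_ideal (lifted_ideal :: ('v, 'e, 'k) free_elem set)
      (free_algebra (lpa_gens E))"
    unfolding algebra_ideal_def by blast
  note I = F.two_sided_idealD[OF two_sided]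
  show add: "p + q \<in> lifted_ideal" if "p \<in> lifted_ideal" "q \<in> lifted_ideal"
    using I(3)[OF that] by simp
  show "p - q \<in> lifted_ideal" if "p \<in> lifted_ideal" "q \<in> lifted_ideal"
    using I(3)[OF that(1) I(4)[OF that(2)]] minus_free_algebra[of p "lpa_gens E" q] that
    by (simp add: F.minus_eq)
  show "p * q \<in> lifted_ideal" if "p \<in> lifted_ideal" "q \<in> carrier (free_algebra (lpa_gens E))"
    using I(6)[OF that(2,1)] by simp
  show "p * q \<in> lifted_ideal" if "q \<in> lifted_ideal" "p \<in> carrier (free_algebra (lpa_gens E))"
    using I(5)[OF that(2,1)] by simp
  show "Poly_Mapping.single 0 c * p \<in> lifted_ideal" if "p \<in> lifted_ideal"
    using ideal that unfolding algebra_ideal_def by simp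
  show zero: "(0 :: ('v, 'e, 'k) free_elem) \<in> lifted_ideal"
    using I(2) by simp
  show "p \<in> lifted_ideal" if "p \<in> lpa_rel_ideal E"
  proof -
    have p: "p \<in> carrier (free_algebra (lpa_gens E))"
      using that by (rule lpa_rel_ideal_closed(2)[OF wf])
    then have "lpa_proj E p = lpa_proj E 0"
      using that by (simp add: lpa_proj_eq_iff[OF wf])
    then show ?thesis
      using zero p by simp
  qed
qed

private lemma lpa_relators_mem_lifted_ideal: "p \<in> lpa_relators E \<Longrightarrow> p \<in> lifted_ideal"
  using lpa_relators_subset_rel_ideal[OF wf] by (intro lifted_ideal_closed(6)) blast

text \<open>The deleted generators are the vertices of \<open>X\<close> and the edges ending in
  \<open>X\<close> with their ghosts. The relations \<open>e r(e) = e\<close> and its ghost version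
  exhibit the latter as multiples of a vertex of \<open>X\<close>.\<close>

private lemma free_gen_mem_lifted_ideal:
  assumes g: "g \<in> lpa_gens E" "g \<notin> lpa_gens Q"
  shows "free_gen g \<in> (lifted_ideal :: ('v, 'e, 'k::field) free_elem set)"
proof -
  have vert: "free_gen (Vert v) \<in> (lifted_ideal :: ('v, 'e, 'k) free_elem set)" if "v \<in> X" for v
    using that X_subset subset_ideal_gen[of "(\<lambda>v. lpa_elem E (Vert v)) ` X"]
    by (auto simp: vertex_ideal_def lpa_elem_eq)
  show ?thesis
  proof (cases g)
    case (Vert v)
    then show ?thesis
      using g vert by simp
  next
    case (Edge e)
    then have "free_gen (Edge e) * free_gen (Vert (head E e)) \<in> (lifted_ideal :: ('v, 'e, 'k) free_elem set)"
      using g by (intro lifted_ideal_closed(4) vert) auto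
    moreover have "free_gen (Edge e) * free_gen (Vert (head E e)) - free_gen (Edge e)
        \<in> (lifted_ideal :: ('v, 'e, 'k) free_elem set)"
      using Edge g by (intro lpa_relators_mem_lifted_ideal lpa_relators_intros) simp
    ultimately show ?thesis
      using lifted_ideal_closed(2) Edge by fastforce
  next
    case (Ghost e)
    then have "free_gen (Vert (head E e)) * free_gen (Ghost e) \<in> (lifted_ideal :: ('v, 'e, 'k) free_elem set)"
      using g by (intro lifted_ideal_closed(3) vert) auto
    moreover have "free_gen (Vert (head E e)) * free_gen (Ghost e) - free_gen (Ghost e)
        \<in> (lifted_ideal :: ('v, 'e, 'k) free_elem set)"
      using Ghost g by (intro lpa_relators_mem_lifted_ideal lpa_relators_intros) simp
    ultimately show ?thesis
      using lifted_ideal_closed(2) Ghost by fastforce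
  qed
qed

text \<open>It suffices to know this for generators: the property survives products because
  \<open>p q - res p res q = (p - res p) q + res p (q - res q)\<close>.\<close>

private lemma diff_restrict_words_mem_lifted_ideal:
  fixes p :: "('v, 'e, 'k::field) free_elem"
  assumes "p \<in> carrier (free_algebra (lpa_gens E))"
  shows "p - res p \<in> lifted_ideal"
  using assms
proof (induction p rule: free_algebra_induct)
  case zero
  then show ?case
    using lifted_ideal_closed(7) by simp
next
  case (gen g)
  then show ?case
    using free_gen_mem_lifted_ideal[of g, where ?'k = 'k] lifted_ideal_closed(7)
    by (cases "g \<in> lpa_gens Q") (simp_all add: restrict_words_free_gen)
next
  case (add p q)
  have "p + q - res (p + q) = (p - res p) + (q - res q)"
    by (simp add: restrict_words_add)
  then show ?case
    using lifted_ideal_closed(1)[OF add.IH] by (simp only:)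
next
  case (smult p c)
  have "Poly_Mapping.single 0 c * p - res (Poly_Mapping.single 0 c * p) =
      Poly_Mapping.single 0 c * (p - res p)"
    by (simp add: restrict_words_mult restrict_words_single zero_free_word_def right_diff_distrib)
  then show ?case
    using lifted_ideal_closed(5)[OF smult.IH] by (simp only:)
next
  case (mult p q)
  have "p * q - res (p * q) = (p - res p) * q + res p * (q - res q)"
    by (simp add: restrict_words_mult algebra_simps)
  moreover have "res p \<in> carrier (free_algebra (lpa_gens E))"
    using restrict_words_mem[OF mult.hyps(1)] lpa_gens_quotient_graph_subset
    by (rule mem_free_algebra_mono)
  ultimately show ?case
    using lifted_ideal_closed(1)[OF lifted_ideal_closed(3)[OF mult.IH(1) mult.hyps(2)]
        lifted_ideal_closed(4)[OF mult.IH(2)]] by (simp only:)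
qed

text \<open>Relators of \<open>Q\<close> are relators of \<open>E\<close>, except that the sum at a
  regular vertex lacks the edges ending in \<open>X\<close>. Those edges lie in the preimage of
  \<open>I(X)\<close>, so adding their terms back changes nothing modulo it.\<close>

private lemma lpa_rel_ideal_quotient_subset: "lpa_rel_ideal Q \<subseteq> lifted_ideal"
proof -
  have "(\<lambda>p. p) \<in> algebra_hom (free_algebra (lpa_gens Q)) (free_algebra (lpa_gens E))"
    using mem_free_algebra_mono[OF _ lpa_gens_quotient_graph_subset] by (auto simp: algebra_hom_def)
  from algebra_ideal_vimage[OF rng_algebra_free_algebra rng_algebra_free_algebra this
      algebra_ideal_vertex_ideal_vimage[OF wf X_subset]]
  have ideal: "algebra_ideal {p \<in> carrier (free_algebra (lpa_gens Q)). p \<in> lifted_ideal}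
      (free_algebra (lpa_gens Q))" .
  have "p \<in> lifted_ideal" if "p \<in> lpa_relators Q" for p :: "('v, 'e, 'k::field) free_elem"
    using that
  proof (cases rule: lpa_relators_cases)
    case (vert_vert v w)
    then show ?thesis
      using lpa_relators_mem_lifted_ideal[OF lpa_relators_intros(1)[of v E w]] by simp
  next
    case (tail_edge e)
    then show ?thesis
      using lpa_relators_mem_lifted_ideal[OF lpa_relators_intros(2)[of e E]] by simp
  next
    case (edge_head e)
    then show ?thesis
      using lpa_relators_mem_lifted_ideal[OF lpa_relators_intros(3)[of e E]] by simp
  next
    case (head_ghost e)
    then show ?thesis
      using lpa_relators_mem_lifted_ideal[OF lpa_relators_intros(4)[of e E]] by simp
  next
    case (ghost_tail e)
    then show ?thesis
      using lpa_relators_mem_lifted_ideal[OF lpa_relators_intros(5)[of e E]] by simp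
  next
    case (ck1 e f)
    then show ?thesis
      using lpa_relators_mem_lifted_ideal[OF lpa_relators_intros(6)[of e E f]]
      by (cases "e = f") simp_all
  next
    case (ck2 v)
    let ?s = "\<lambda>S. \<Sum>e\<in>S. free_gen (Edge e) * free_gen (Ghost e) :: ('v, 'e, 'k) free_elem"
    have v: "v \<in> verts E" "out_arcs E v \<noteq> {}"
      using ck2 by (auto simp: regular_vertex_def)
    \<comment> \<open>Regularity in \<open>Q\<close> bounds only the surviving edges; finiteness of
      all edges at \<open>v\<close> comes from row-finiteness of \<open>E\<close>.\<close>
    then have reg: "regular_vertex E v"
      using E by (simp add: regular_vertex_def row_finite_def)
    then have fin: "finite (out_arcs E v)"
      by (simp add: regular_vertex_def)
    have "?s S \<in> lifted_ideal" if "finite S" "S \<subseteq> out_arcs E v - out_arcs Q v" for S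
      using that
    proof induction
      case empty
      then show ?case
        using lifted_ideal_closed(7) by simp
    next
      case (insert e S)
      then have "free_gen (Edge e) * free_gen (Ghost e) \<in> (lifted_ideal :: ('v, 'e, 'k) free_elem set)"
        by (intro lifted_ideal_closed(3) free_gen_mem_lifted_ideal) auto
      from lifted_ideal_closed(1)[OF this insert.IH] show ?case
        using insert by simp
    qed
    then have "?s (out_arcs E v - out_arcs Q v) \<in> lifted_ideal"
      using fin by blast
    moreover have "free_gen (Vert v) - ?s (out_arcs E v) \<in> lifted_ideal"
      by (rule lpa_relators_mem_lifted_ideal[OF lpa_relators_intros(7)[OF reg]])
    moreover have "?s (out_arcs E v) = ?s (out_arcs E v - out_arcs Q v) + ?s (out_arcs Q v)"
      using fin by (intro sum.subset_diff) auto
    then have "p = (free_gen (Vert v) - ?s (out_arcs E v)) + ?s (out_arcs E v - out_arcs Q v)"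
      using ck2 by simp
    ultimately show ?thesis
      using lifted_ideal_closed(1) by blast
  qed
  then have "lpa_rel_ideal Q \<subseteq> {p \<in> carrier (free_algebra (lpa_gens Q)). p \<in> lifted_ideal}"
    unfolding lpa_rel_ideal_def using lpa_relators_subset[OF wfQ]
    by (intro algebra_ideal_gen_least[OF ideal]) blast
  then show ?thesis
    by blast
qed

text \<open>From right to left, split \<open>p\<close> as \<open>(p - res p) + res p\<close>. From
  left to right, the set \<open>?J\<close> of all \<open>p\<close> satisfying the right-hand side is
  an ideal containing the relations of \<open>E\<close> and the vertices of \<open>X\<close>, so its
  image contains \<open>I(X)\<close>.\<close>

lemma lpa_proj_mem_vertex_ideal_iff:
  fixes p :: "('v, 'e, 'k::field) free_elem"
  assumes p: "p \<in> carrier (free_algebra (lpa_gens E))"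
  shows "lpa_proj E p \<in> vertex_ideal E X \<longleftrightarrow> res p \<in> lpa_rel_ideal Q"
proof
  assume "res p \<in> lpa_rel_ideal Q"
  then have "res p \<in> lifted_ideal"
    using lpa_rel_ideal_quotient_subset by blast
  then have "(p - res p) + res p \<in> lifted_ideal"
    by (rule lifted_ideal_closed(1)[OF diff_restrict_words_mem_lifted_ideal[OF p]])
  then show "lpa_proj E p \<in> vertex_ideal E X"
    by simp
next
  let ?J = "{p \<in> carrier (free_algebra (lpa_gens E)). res p \<in> lpa_rel_ideal Q}
    :: ('v, 'e, 'k) free_elem set"
  have J: "algebra_ideal ?J (free_algebra (lpa_gens E))"
    by (rule algebra_ideal_vimage[OF rng_algebra_free_algebra rng_algebra_free_algebra
          restrict_words_hom algebra_ideal_lpa_rel_ideal[OF wfQ]])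
  have rel: "lpa_rel_ideal E \<subseteq> ?J"
    unfolding lpa_rel_ideal_def[of E]
    using restrict_words_lpa_relators lpa_relators_subset[OF wf]
    by (intro algebra_ideal_gen_least[OF J]) blast
  have "two_sided_ideal (lpa_proj E ` ?J) (lpa E)"
    using algebra_ideal_image[OF rng_algebra_free_algebra rng_algebra_lpa[OF wf] lpa_proj_hom[OF wf]
        J lpa_proj_surj[OF wf]] unfolding algebra_ideal_def by blast
  moreover have "(\<lambda>v. lpa_elem E (Vert v)) ` X \<subseteq> lpa_proj E ` ?J"
    using X_subset
    by (auto simp: lpa_elem_eq restrict_words_free_gen lpa_rel_ideal_closed(1)[OF wfQ] intro!: imageI)
  ultimately have sub: "vertex_ideal E X \<subseteq> lpa_proj E ` ?J"
    unfolding vertex_ideal_def by (rule ideal_gen_least)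
  assume "lpa_proj E p \<in> vertex_ideal E X"
  then obtain q where q: "q \<in> ?J" "lpa_proj E p = lpa_proj E q"
    using sub by blast
  \<comment> \<open>Only some representative \<open>q\<close> of the class is known to lie in
    \<open>?J\<close>; since \<open>?J\<close> contains the relation ideal, \<open>p\<close> does as
    well.\<close>
  then have "p - q \<in> ?J"
    using p rel lpa_proj_eq_iff[OF wf p, of q] by blast
  then have "res (p - q) + res q \<in> lpa_rel_ideal Q"
    using q by (intro lpa_rel_ideal_closed(3)[OF wfQ]) simp_all
  then show "res p \<in> lpa_rel_ideal Q"
    by (simp add: restrict_words_diff)
qed

lemma lpa_proj_restrict_words_eq_iff:
  assumes "p \<in> carrier (free_algebra (lpa_gens E))" "q \<in> carrier (free_algebra (lpa_gens E))"
  shows "lpa_proj Q (res p) = lpa_proj Q (res q) \<longleftrightarrow> lpa_proj E (p - q) \<in> vertex_ideal E X"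
  using assms
  by (simp add: lpa_proj_eq_iff[OF wfQ] restrict_words_mem[OF assms(1)] restrict_words_mem[OF assms(2)]
      lpa_proj_mem_vertex_ideal_iff free_algebra_closed restrict_words_diff)

text \<open>A vertex outside \<open>X\<close> survives deletion and is nonzero in
  \<open>L(E/X)\<close>. Thus \<open>X\<close> can be recovered from \<open>I(X)\<close>.\<close>

lemma Vert_mem_vertex_ideal_iff:
  assumes "v \<in> verts E"
  shows "lpa_proj E (free_gen (Vert v) :: ('v, 'e, 'k::field) free_elem) \<in> vertex_ideal E X \<longleftrightarrow>
    v \<in> X"
  using assms lpa_proj_mem_vertex_ideal_iff[of "free_gen (Vert v) :: ('v, 'e, 'k) free_elem"]
    Vert_notin_lpa_rel_ideal[OF row_finite_quotient_graph[OF E X(1)], of v, where ?'k = 'k]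
    lpa_rel_ideal_closed(1)[OF wfQ, where ?'k = 'k]
  by (auto simp: restrict_words_free_gen)

text \<open>The maps \<open>?f\<close> onto \<open>L(E)/I(X)\<close> and \<open>?g\<close> onto
  \<open>L(E/X)\<close> start from the same free algebra and have the same fibres, so an isomorphism
  exists. It is unique because its composite with \<open>?f\<close> is determined on generators, and
  off the carrier by extensionality.\<close>

lemma canonical_iso_lpa_class:
  fixes p :: "('v, 'e, 'k::field) free_elem"
  assumes "p \<in> carrier (free_algebra (lpa_gens E))"
  shows "canonical_iso E X (lpa_class E X (lpa_proj E p)) = lpa_proj Q (res p)"
proof -
  let ?F = "free_algebra (lpa_gens E) :: ('k, ('v, 'e, 'k) free_elem) module"
  let ?f = "\<lambda>p :: ('v, 'e, 'k) free_elem. lpa_class E X (lpa_proj E p)"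
  let ?g = "\<lambda>p :: ('v, 'e, 'k) free_elem. lpa_proj Q (res p)"
  let ?P = "\<lambda>\<theta>. \<theta> \<in> extensional (carrier (lpa_mod E X)) \<and>
     \<theta> \<in> algebra_iso (lpa_mod E X) (lpa Q) \<and>
     (\<forall>v\<in>verts E - X. \<theta> (lpa_class E X (lpa_elem E (Vert v))) = (lpa_elem Q (Vert v))) \<and>
     (\<forall>e\<in>arcs E. head E e \<notin> X \<longrightarrow>
        \<theta> (lpa_class E X (lpa_elem E (Edge e))) = lpa_elem Q (Edge e) \<and>
        \<theta> (lpa_class E X (lpa_elem E (Ghost e))) = (lpa_elem Q (Ghost e) :: ('v, 'e, 'k) free_elem set))"
  interpret F: rng_algebra ?F
    by (rule rng_algebra_free_algebra)
  note rngs = rng_algebra_free_algebra rng_algebra_lpa[OF wfQ] rng_algebra_lpa_mod[OF wf X_subset]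
  have f: "?f \<in> algebra_hom ?F (lpa_mod E X)"
    by (rule algebra_hom_comp[OF lpa_proj_hom[OF wf] lpa_class_hom[OF wf X_subset]])
  have g: "?g \<in> algebra_hom ?F (lpa Q)"
    by (rule algebra_hom_comp[OF restrict_words_hom lpa_proj_hom[OF wfQ]])
  have f_surj: "?f ` carrier ?F = carrier (lpa_mod E X)"
    unfolding lpa_class_surj[OF wf X_subset, symmetric] lpa_proj_surj[OF wf, symmetric] image_image ..
  have "carrier (free_algebra (lpa_gens Q)) \<subseteq> res ` carrier ?F"
  proof
    fix p :: "('v, 'e, 'k) free_elem" assume p: "p \<in> carrier (free_algebra (lpa_gens Q))"
    then have "p = res p" "p \<in> carrier ?F"
      by (simp_all add: restrict_words_id mem_free_algebra_mono[OF _ lpa_gens_quotient_graph_subset])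
    then show "p \<in> res ` carrier ?F"
      by (rule image_eqI)
  qed
  then have "res ` carrier ?F = carrier (free_algebra (lpa_gens Q))"
    using restrict_words_mem by blast
  then have g_surj: "?g ` carrier ?F = carrier (lpa Q)"
    unfolding lpa_proj_surj[OF wfQ, symmetric] by (metis image_image)
  have ker: "?f x = ?f y \<longleftrightarrow> ?g x = ?g y" if "x \<in> carrier ?F" "y \<in> carrier ?F" for x y
    using that by (simp add: lpa_class_proj_eq_iff[OF wf X_subset] lpa_proj_restrict_words_eq_iff)
  obtain \<theta> where \<theta>: "\<theta> \<in> algebra_iso (lpa_mod E X) (lpa Q)"
    "\<And>x. x \<in> carrier ?F \<Longrightarrow> \<theta> (?f x) = ?g x" "\<theta> \<in> extensional (carrier (lpa_mod E X))"
    by (rule algebra_iso_of_surj[OF f f_surj g g_surj ker]) (auto simp: free_algebra_closed)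
  have "canonical_iso E X = \<theta>"
    unfolding canonical_iso_def
  proof (rule the_equality)
    show "?P \<theta>"
      using \<theta> by (auto simp: lpa_elem_eq restrict_words_free_gen)
  next
    fix \<theta>' assume P: "?P \<theta>'"
    then have "\<theta>' \<in> algebra_iso (lpa_mod E X) (lpa Q)"
      by blast
    then have hom: "(\<lambda>p. \<theta>' (?f p)) \<in> algebra_hom ?F (lpa Q)"
      by (intro algebra_hom_comp[OF f] algebra_iso_imp_hom)
    have eq: "\<theta>' (?f p) = ?g p" if "p \<in> carrier ?F" for p
    proof (rule algebra_hom_free_algebra_eqI[OF hom g rngs(2) _ that])
      fix a assume a: "a \<in> lpa_gens E"
      show "\<theta>' (?f (free_gen a)) = ?g (free_gen a)"
      proof (cases "a \<in> lpa_gens Q")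
        case True
        then show ?thesis
          using P by (cases a) (auto simp: lpa_elem_eq restrict_words_free_gen)
      next
        \<comment> \<open>No value is prescribed for a deleted generator. But \<open>?g\<close>
          sends it where it sends 0, hence so does \<open>?f\<close>, and every candidate must agree
          there.\<close>
        case False
        then have g0: "?g (free_gen a) = ?g 0"
          by (simp add: restrict_words_free_gen)
        then have "?f (free_gen a) = ?f 0"
          using a by (subst ker) auto
        then have "\<theta>' (?f (free_gen a)) = \<theta>' (?f 0)"
          by simp
        also have "\<dots> = ?g 0"
          using algebra_hom_zero[OF rngs(1,2) hom] algebra_hom_zero[OF rngs(1,2) g] by simp
        finally show ?thesis
          using g0 by simp
      qed
    qed
    show "\<theta>' = \<theta>"
    proof (rule extensionalityI)
      show "\<theta>' \<in> extensional (carrier (lpa_mod E X))"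
        using P by blast
      fix x :: "('v, 'e, 'k) free_elem set set" assume "x \<in> carrier (lpa_mod E X)"
      then obtain p where "p \<in> carrier ?F" "x = ?f p"
        using f_surj by blast
      then show "\<theta>' x = \<theta> x"
        using eq \<theta>(2) by simp
    qed (rule \<theta>(3))
  qed
  then show ?thesis
    using \<theta>(2) assms by simp
qed

lemma canonical_iso_image:
  assumes Z: "Z \<subseteq> verts E"
  shows "canonical_iso E X ` lpa_class E X ` (vertex_ideal E Z :: ('v, 'e, 'k::field) free_elem set set) =
    (\<lambda>p. lpa_proj Q (res p)) `
      {p \<in> carrier (free_algebra (lpa_gens E)). lpa_proj E p \<in> vertex_ideal E Z}"
    (is "_ = _ ` ?J")
proof -
  interpret L: rng_algebra "lpa E :: ('k, ('v, 'e, 'k) free_elem set) module"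
    by (rule rng_algebra_lpa[OF wf])
  have "(vertex_ideal E Z :: ('v, 'e, 'k) free_elem set set) \<subseteq> carrier (lpa E)"
    using algebra_ideal_vertex_ideal[OF wf Z] unfolding algebra_ideal_def
    by (blast dest: L.two_sided_idealD(1))
  then have "vertex_ideal E Z = lpa_proj E ` ?J"
    unfolding lpa_proj_surj[OF wf, symmetric] by blast
  then have "canonical_iso E X ` lpa_class E X ` vertex_ideal E Z =
      (\<lambda>p. canonical_iso E X (lpa_class E X (lpa_proj E p))) ` ?J"
    by (metis image_image)
  also have "\<dots> = (\<lambda>p. lpa_proj Q (res p)) ` ?J"
    by (intro image_cong canonical_iso_lpa_class) auto
  finally show ?thesis .
qed

end

text \<open>If \<open>v\<close> is in \<open>Z'\<close>, its image under \<open>\<theta>\<close> is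
  also the image of some \<open>p\<close> from \<open>I(Z)\<close>. By injectivity
  \<open>v - p\<close> is in \<open>I(X)\<close>, which lies in \<open>I(Z)\<close>, so
  \<open>v\<close> is in \<open>I(Z)\<close> and therefore in \<open>Z\<close>. As an inclusion the
  statement can be applied in both directions to identify the set in
  \<open>point_star\<close>.\<close>

lemma canonical_iso_image_subset_imp:
  assumes E: "row_finite E" and X: "hereditary E X" "saturated E X"
    and Z: "hereditary E Z" "saturated E Z" "X \<subseteq> Z"
    and Z': "hereditary E Z'" "saturated E Z'"
    and eq: "canonical_iso E X ` lpa_class E X `
        (vertex_ideal E Z' :: ('v, 'e, 'k::field) free_elem set set) \<subseteq>
      canonical_iso E X ` lpa_class E X ` vertex_ideal E Z"
  shows "Z' \<subseteq> Z"
proof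
  fix v assume v: "v \<in> Z'"
  let ?v = "free_gen (Vert v) :: ('v, 'e, 'k) free_elem"
  let ?res = "restrict_words (lpa_gens (quotient_graph E X))"
  have wf: "wf_digraph E"
    using E by (simp add: row_finite_def)
  let ?J = "{p \<in> carrier (free_algebra (lpa_gens E)). lpa_proj E p \<in> vertex_ideal E Z} :: ('v, 'e, 'k) free_elem set"
  have sub: "Z \<subseteq> verts E" "Z' \<subseteq> verts E"
    using Z(1) Z'(1) by (simp_all add: hereditary_def)
  then have v': "v \<in> verts E" and mem: "?v \<in> carrier (free_algebra (lpa_gens E))"
    using v by auto
  have vertex_mem: "lpa_proj E ?v \<in> vertex_ideal E W \<longleftrightarrow> v \<in> W" if "hereditary E W" "saturated E W" for W
    by (rule Vert_mem_vertex_ideal_iff[OF E that v'])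
  have "lpa_proj E ?v \<in> vertex_ideal E Z'"
    using vertex_mem[OF Z'] v by simp
  then have "lpa_proj (quotient_graph E X) (?res ?v) \<in> (\<lambda>p. lpa_proj (quotient_graph E X) (?res p)) ` ?J"
    using eq mem unfolding canonical_iso_image[OF E X sub(1)] canonical_iso_image[OF E X sub(2)]
    by blast
  then obtain p where p: "p \<in> ?J" "lpa_proj (quotient_graph E X) (?res ?v) = lpa_proj (quotient_graph E X) (?res p)"
    by blast
  then have "lpa_proj E (?v - p) \<in> vertex_ideal E X"
    using lpa_proj_restrict_words_eq_iff[OF E X mem] by blast
  then have "?v - p \<in> ?J"
    using vertex_ideal_mono[OF Z(3), of E] free_algebra_closed(2)[OF mem, of p] p by blast
  moreover have "algebra_ideal ?J (free_algebra (lpa_gens E))"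
    by (rule algebra_ideal_vertex_ideal_vimage[OF wf sub(1)])
  then have "two_sided_ideal ?J (free_algebra (lpa_gens E))"
    unfolding algebra_ideal_def by blast
  ultimately have "(?v - p) + p \<in> ?J"
    using rng_algebra.two_sided_idealD(3)[OF rng_algebra_free_algebra] p(1) by fastforce
  then show "v \<in> Z"
    using vertex_mem[OF Z(1,2)] by simp
qed

section \<open>Products of point functors\<close>

lemma hereditary_saturated_functorD:
  assumes "hereditary_saturated_functor H" "row_finite E"
  shows "hereditary E (H E)" "saturated E (H E)" "H E \<subseteq> verts E"
  using assms by (auto simp: hereditary_saturated_functor_def hereditary_def)

context
  fixes E :: "('v, 'e) pre_digraph" and X Y :: "'v set"
  assumes E: "row_finite E" and X: "hereditary E X" "saturated E X"
    and Y: "hereditary (quotient_graph E X) Y" "saturated (quotient_graph E X) Y"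
begin

private abbreviation "Q' \<equiv> quotient_graph E X"
private abbreviation "res' \<equiv> restrict_words (lpa_gens Q')"
private abbreviation "free_lpa G \<equiv> carrier (free_algebra (lpa_gens G))"

private lemmas Un = hereditary_saturated_Un[OF E X Y]

private lemma quot: "row_finite Q'" "wf_digraph Q'"
  using row_finite_quotient_graph[OF E X(1)] by (simp_all add: row_finite_def)

private lemma Un_subset: "X \<union> Y \<subseteq> verts E" "Y \<subseteq> verts Q'"
  using Un(1) Y(1) by (simp_all add: hereditary_def)

lemma canonical_iso_image_Un:
  "canonical_iso E X ` lpa_class E X `
      (vertex_ideal E (X \<union> Y) :: ('v, 'e, 'k::field) free_elem set set) = vertex_ideal Q' Y"
proof -
  let ?J = "{p \<in> free_lpa E. lpa_proj E p \<in> vertex_ideal E (X \<union> Y)} :: ('v, 'e, 'k) free_elem set"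
  let ?J' = "{p \<in> free_lpa Q'. lpa_proj Q' p \<in> vertex_ideal Q' Y} :: ('v, 'e, 'k) free_elem set"
  interpret L: rng_algebra "lpa Q' :: ('k, ('v, 'e, 'k) free_elem set) module"
    by (rule rng_algebra_lpa[OF quot(2)])
  have sub: "free_lpa Q' \<subseteq> (free_lpa E :: ('v, 'e, 'k) free_elem set)"
    using mem_free_algebra_mono[OF _ lpa_gens_quotient_graph_subset] by blast
  \<comment> \<open>Both sides say that \<open>p\<close>, cut down to the generators of
    \<open>E/(X \<union> Y)\<close>, falls into the relation ideal of that graph; deleting first
    along \<open>X\<close> does not alter the result.\<close>
  have iff: "lpa_proj Q' (res' p) \<in> vertex_ideal Q' Y \<longleftrightarrow> lpa_proj E p \<in> vertex_ideal E (X \<union> Y)"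
    if "p \<in> free_lpa E" for p :: "('v, 'e, 'k) free_elem"
    using that restrict_words_mem[OF that]
    by (simp add: lpa_proj_mem_vertex_ideal_iff[OF quot(1) Y] lpa_proj_mem_vertex_ideal_iff[OF E Un]
        quotient_graph_quotient_graph restrict_words_restrict_words lpa_gens_quotient_graph_Int)
  have res_J: "res' ` ?J = ?J'"
  \<comment> \<open>Every element over \<open>Q'\<close> is its own deletion, which gives the
    reverse inclusion.\<close>
  proof (intro equalityI subsetI)
    fix p assume "p \<in> res' ` ?J"
    then show "p \<in> ?J'"
      using iff by (auto intro: restrict_words_mem)
  next
    fix p assume p: "p \<in> ?J'"
    then have "p = res' p" "p \<in> free_lpa E"
      using sub by (auto simp: restrict_words_id)
    then show "p \<in> res' ` ?J"
      using p iff[of p] by (intro image_eqI[of p res' p]) auto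
  qed
  have "(vertex_ideal Q' Y :: ('v, 'e, 'k) free_elem set set) \<subseteq> carrier (lpa Q')"
    using algebra_ideal_vertex_ideal[OF quot(2) Un_subset(2)] unfolding algebra_ideal_def
    by (blast dest: L.two_sided_idealD(1))
  then have "vertex_ideal Q' Y = lpa_proj Q' ` ?J'"
    unfolding lpa_proj_surj[OF quot(2), symmetric] by blast
  moreover have "canonical_iso E X ` lpa_class E X ` vertex_ideal E (X \<union> Y) = lpa_proj Q' ` res' ` ?J"
    unfolding canonical_iso_image[OF E X Un_subset(1)] by (simp only: image_image)
  ultimately show ?thesis
    using res_J by (metis (no_types, lifting))
qed

end

text \<open>The union is a solution of the defining description by
  \<open>canonical_iso_image_Un\<close>; any other solution is compared with it by
  \<open>canonical_iso_image_subset_imp\<close> in both directions.\<close>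

theorem point_star_eq:
  assumes E: "row_finite E"
    and H1: "hereditary_saturated_functor H1" and H2: "hereditary_saturated_functor H2"
  shows "point_star TYPE('k::field) H2 H1 E = H1 E \<union> H2 (quotient_graph E (H1 E))"
proof -
  let ?X = "H1 E" and ?Y = "H2 (quotient_graph E (H1 E))"
  note X = hereditary_saturated_functorD(1,2)[OF H1 E]
  note Y = hereditary_saturated_functorD(1,2)[OF H2 row_finite_quotient_graph[OF E X(1)]]
  note Z = hereditary_saturated_Un[OF E X Y]
  note image = canonical_iso_image_Un[OF E X Y, where ?'k = 'k]
  show ?thesis
    unfolding point_star_def
  proof (rule the_equality)
    fix Z' assume Z': "hereditary E Z' \<and> saturated E Z' \<and> ?X \<subseteq> Z' \<and>
      canonical_iso E ?X ` lpa_class E ?X ` (vertex_ideal E Z' :: ('a, 'b, 'k) free_elem set set) =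
      vertex_ideal (quotient_graph E ?X) ?Y"
    show "Z' = ?X \<union> ?Y"
    proof (rule equalityI)
      show "Z' \<subseteq> ?X \<union> ?Y"
        by (rule canonical_iso_image_subset_imp[OF E X Z _ _ _ eq_refl, where ?'k = 'k])
          (use Z' image in auto)
      show "?X \<union> ?Y \<subseteq> Z'"
        by (rule canonical_iso_image_subset_imp[OF E X _ _ _ Z eq_refl, where ?'k = 'k])
          (use Z' image in auto)
    qed
  qed (use Z image in simp)
qed

lemma hereditary_saturated_functor_point_star:
  assumes "hereditary_saturated_functor H1" "hereditary_saturated_functor H2"
  shows "hereditary_saturated_functor (point_star TYPE('k::field) H2 H1)"
  unfolding hereditary_saturated_functor_def
proof (intro allI impI)
  fix E :: "('a, 'b) pre_digraph" assume E: "row_finite E"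
  note X = hereditary_saturated_functorD(1,2)[OF assms(1) E]
  note Y = hereditary_saturated_functorD(1,2)[OF assms(2) row_finite_quotient_graph[OF E X(1)]]
  show "hereditary E (point_star TYPE('k) H2 H1 E) \<and> saturated E (point_star TYPE('k) H2 H1 E)"
    using hereditary_saturated_Un[OF E X Y] by (simp add: point_star_eq[OF E assms])
qed

section \<open>Functoriality of the product and the associativity isomorphism\<close>

lemma graph_iso_sym:
  assumes "graph_iso E F \<phi>"
  shows "graph_iso F E (pre_digraph.inv_iso E \<phi>)"
proof -
  have iso: "pre_digraph.digraph_isomorphism E \<phi>" and F: "F = app_iso \<phi> E"
    using assms by (simp_all add: graph_iso_def)
  then interpret wf_digraph E
    by (simp add: pre_digraph.digraph_isomorphism_def)
  show ?thesis
    using digraph_isomorphism_invI[OF iso] app_iso_inv[OF iso] by (simp add: graph_iso_def F)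
qed

text \<open>The definition demands an inclusion for every isomorphism; applied to the inverse it
  gives the other one. Equality is what makes an isomorphism descend to \<open>E/H(E)\<close> and
  \<open>F/H(F)\<close>.\<close>

lemma point_functor_image_eq:
  assumes H: "point_functor H" and E: "row_finite E" and F: "row_finite F"
    and iso: "graph_iso E F \<phi>"
  shows "iso_verts \<phi> ` H E = H F"
proof
  show "iso_verts \<phi> ` H E \<subseteq> H F"
    using assms by (auto simp: point_functor_def)
  show "H F \<subseteq> iso_verts \<phi> ` H E"
  proof
    fix y assume y: "y \<in> H F"
    let ?x = "iso_verts (pre_digraph.inv_iso E \<phi>) y"
    have "iso_verts (pre_digraph.inv_iso E \<phi>) ` H F \<subseteq> H E"
      using H E F graph_iso_sym[OF iso] unfolding point_functor_def by blast
    then have "?x \<in> H E"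
      using y by blast
    moreover have "iso_verts \<phi> ?x = y"
      using iso y H F pre_digraph.iso_verts_iso_inv[of E \<phi> y]
      by (auto simp: graph_iso_def point_functor_def)
    ultimately show "y \<in> iso_verts \<phi> ` H E"
      by (metis image_eqI)
  qed
qed

text \<open>The same record \<open>\<phi>\<close> serves for the quotients. Injectivity on vertices
  ensures that an edge ends in \<open>X\<close> exactly when its image ends in the image of
  \<open>X\<close>, so the removed edges correspond.\<close>

lemma graph_iso_quotient_graph:
  assumes iso: "graph_iso E F \<phi>" and X: "X \<subseteq> verts E"
    and wf: "wf_digraph (quotient_graph E X)"
  shows "graph_iso (quotient_graph E X) (quotient_graph F (iso_verts \<phi> ` X)) \<phi>"
proof -
  have inj: "inj_on (iso_verts \<phi>) (verts E)" "inj_on (iso_arcs \<phi>) (arcs E)"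
    and compat: "\<And>a. a \<in> arcs E \<Longrightarrow> iso_verts \<phi> (tail E a) = iso_tail \<phi> (iso_arcs \<phi> a)"
      "\<And>a. a \<in> arcs E \<Longrightarrow> iso_head \<phi> (iso_arcs \<phi> a) = iso_verts \<phi> (head E a)"
    and F: "F = app_iso \<phi> E" and wfE: "wf_digraph E"
    using iso by (auto simp: graph_iso_def pre_digraph.digraph_isomorphism_def)
  have "pre_digraph.digraph_isomorphism (quotient_graph E X) \<phi>"
    using wf inj compat
    by (auto simp: pre_digraph.digraph_isomorphism_def elim: inj_on_subset)
  moreover have "iso_verts \<phi> ` (verts E - X) = iso_verts \<phi> ` verts E - iso_verts \<phi> ` X"
    by (rule inj_on_image_set_diff[OF inj(1)]) (use X in auto)
  moreover have "iso_head \<phi> (iso_arcs \<phi> e) \<in> iso_verts \<phi> ` X \<longleftrightarrow> head E e \<in> X" if "e \<in> arcs E" for e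
    using that inj_on_image_mem_iff[OF inj(1) _ X] wf_digraph.head_in_verts[OF wfE]
    by (simp add: compat(2))
  then have "iso_arcs \<phi> ` {e \<in> arcs E. head E e \<notin> X} =
      {e \<in> iso_arcs \<phi> ` arcs E. iso_head \<phi> e \<notin> iso_verts \<phi> ` X}"
    by blast
  ultimately show ?thesis
    by (simp add: graph_iso_def F app_iso_def quotient_graph_def)
qed

lemma point_functor_point_star:
  assumes pf: "point_functor H1" "point_functor H2"
    and hs: "hereditary_saturated_functor H1" "hereditary_saturated_functor H2"
  shows "point_functor (point_star TYPE('k::field) H2 H1)"
proof -
  have "iso_verts \<phi> ` point_star TYPE('k) H2 H1 E \<subseteq> point_star TYPE('k) H2 H1 F"
    if E: "row_finite E" and F: "row_finite F" and iso: "graph_iso E F \<phi>" for E F \<phi>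
  proof -
    note X = hereditary_saturated_functorD[OF hs(1) E]
    note X' = hereditary_saturated_functorD[OF hs(1) F]
    have image: "iso_verts \<phi> ` H1 E = H1 F"
      by (rule point_functor_image_eq[OF pf(1) E F iso])
    have Q: "row_finite (quotient_graph E (H1 E))" "row_finite (quotient_graph F (H1 F))"
      by (rule row_finite_quotient_graph[OF E X(1)] row_finite_quotient_graph[OF F X'(1)])+
    then have "graph_iso (quotient_graph E (H1 E)) (quotient_graph F (H1 F)) \<phi>"
      using graph_iso_quotient_graph[OF iso X(3)] image by (simp add: row_finite_def)
    from point_functor_image_eq[OF pf(2) Q this] show ?thesis
      by (simp add: point_star_eq[OF E hs] point_star_eq[OF F hs] image image_Un)
  qed
  moreover have "point_star TYPE('k) H2 H1 E \<subseteq> verts E" if "row_finite E" for E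
    using hereditary_saturated_functorD(3)[OF hereditary_saturated_functor_point_star[OF hs] that] .
  ultimately show ?thesis
    by (auto simp: point_functor_def)
qed

lemma natural_isomorphism_refl:
  assumes "point_functor H" "point_functor H'" "\<And>E. row_finite E \<Longrightarrow> H E = H' E"
  shows "natural_isomorphism H H' (\<lambda>_ x. x)"
  using assms unfolding natural_isomorphism_def natural_transformation_def
  by (auto intro!: exI[of _ "\<lambda>_ x. x"])

theorem proposition5p7:
  fixes H1 H2 H3 :: "('v, 'e) pre_digraph \<Rightarrow> 'v set"
  assumes "point_functor H1" and "point_functor H2" and "point_functor H3"
    and "hereditary_saturated_functor H1"
    and "hereditary_saturated_functor H2"
    and "hereditary_saturated_functor H3"
    and "invariant_under_iso TYPE('k::field) H1"
    and "invariant_under_iso TYPE('k) H2"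
    and "invariant_under_iso TYPE('k) H3"
  shows "\<exists>\<eta>. natural_isomorphism
           (point_star TYPE('k) (point_star TYPE('k) H1 H2) H3)
           (point_star TYPE('k) H1 (point_star TYPE('k) H2 H3)) \<eta>"
proof -
  note pf = assms(1-3) and hs = assms(4-6)
  note hs12 = hereditary_saturated_functor_point_star[OF hs(2,1), where ?'k = 'k]
  note hs23 = hereditary_saturated_functor_point_star[OF hs(3,2), where ?'k = 'k]
  have "point_functor (point_star TYPE('k) (point_star TYPE('k) H1 H2) H3)"
    by (intro point_functor_point_star pf hs hs12)
  moreover have "point_functor (point_star TYPE('k) H1 (point_star TYPE('k) H2 H3))"
    by (intro point_functor_point_star pf hs hs23)
  moreover have "point_star TYPE('k) (point_star TYPE('k) H1 H2) H3 E =
      point_star TYPE('k) H1 (point_star TYPE('k) H2 H3) E" if E: "row_finite E" for E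
  proof -
    have "row_finite (quotient_graph E (H3 E))"
      by (rule row_finite_quotient_graph[OF E hereditary_saturated_functorD(1)[OF hs(3) E]])
    \<comment> \<open>With \<open>X = H3 E\<close> and \<open>Y = H2 (E/X)\<close>, both sides
      unfold to \<open>X \<union> Y \<union> H1 (E/(X \<union> Y))\<close>; on the left the last
      graph first appears as an iterated quotient.\<close>
    then show ?thesis
      by (simp add: point_star_eq[OF _ hs(3) hs12] point_star_eq[OF _ hs(2,1)]
          point_star_eq[OF _ hs23 hs(1)] point_star_eq[OF _ hs(3,2)] E
          quotient_graph_quotient_graph Un_assoc)
  qed
  ultimately show ?thesis
    by (blast intro: natural_isomorphism_refl)
qed

end
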